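(* Let $d\in\mathbb{N}$, and let $(Q_n)_n$ be a sequence of distributions in $\mathcal{Q}_o$ converging weakly to some $Q\in\mathcal{Q}_o$. Then $$\limsup_{n\to\infty}L(Q_n)\le L(Q).$$ Moreover, $\liminf_{n\to\infty}L(Q_n)<L(Q)$ if and only if $$\limsup_{n\to\infty}\int\|x\|\,Q_n(dx)>\int\|x\|\,Q(dx).$$
   Context: $\mathcal{Q}_o=\mathcal{Q}_o(d)$ is the set of probability distributions $Q$ on $\mathbb{R}^d$ whose convex support $\operatorname{csupp}(Q):=\bigcap\{C:C\subseteq\mathbb{R}^d\text{ closed and convex},\ Q(C)=1\}$ has nonempty interior. $\Phi=\Phi(d)$ is the family of concave functions $\phi:\mathbb{R}^d\to[-\infty,\infty)$ which are upper semicontinuous and coercive ($\phi(x)\to-\infty$ as $\|x\|\to\infty$). For a probability distribution $Q$ on $\mathbb{R}^d$ and $\phi\in\Phi$, $$L(\phi,Q):=\int\phi\,dQ-\int e^{\phi(x)}\,dx+1,\qquad L(Q):=\sup_{\phi\in\Phi}L(\phi,Q)\in[-\infty,\infty].$$ First moments $\int\|x\|\,Q(dx)$ take values in $[0,\infty]$. *)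

theory Defs
  imports "HOL-Probability.Probability"
begin

text \<open>The space \<open>\<real>\<^sup>d\<close> is a type of class \<^class>\<open>euclidean_space\<close>, so that \<open>d = DIM('a) \<ge> 1\<close> is arbitrary.\<close>

definition distributions :: "'a::euclidean_space measure set" where
  "distributions = {Q. prob_space Q \<and> sets Q = sets borel}"

definition csupp :: "'a::euclidean_space measure \<Rightarrow> 'a set" where
  "csupp Q = \<Inter>{C. closed C \<and> convex C \<and> measure Q C = 1}"

definition Qo :: "'a::euclidean_space measure set" where
  "Qo = {Q \<in> distributions. interior (csupp Q) \<noteq> {}}"

definition weakly_converges ::
    "(nat \<Rightarrow> 'a::euclidean_space measure) \<Rightarrow> 'a measure \<Rightarrow> bool" where
  "weakly_converges Qs Q \<longleftrightarrow>
     (\<forall>f::'a \<Rightarrow> real. continuous_on UNIV f \<and> bounded (range f) \<longrightarrow>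
        (\<lambda>n. integral\<^sup>L (Qs n) f) \<longlonglongrightarrow> integral\<^sup>L Q f)"

text \<open>For \<open>\<phi> < \<infinity>\<close> the sum on the left never has the form \<open>\<infinity> + (-\<infinity>)\<close>; moreover \<open>0 * (-\<infinity>) = 0\<close>
  in \<^typ>\<open>ereal\<close>, so the weights \<open>0\<close> and \<open>1\<close> impose nothing.\<close>

definition ext_concave :: "('a::real_vector \<Rightarrow> ereal) \<Rightarrow> bool" where
  "ext_concave \<phi> \<longleftrightarrow>
     (\<forall>x y. \<forall>u\<ge>0. \<forall>v\<ge>0. u + v = 1 \<longrightarrow>
        ereal u * \<phi> x + ereal v * \<phi> y \<le> \<phi> (u *\<^sub>R x + v *\<^sub>R y))"

definition upper_semicontinuous :: "('a::topological_space \<Rightarrow> ereal) \<Rightarrow> bool" where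
  "upper_semicontinuous \<phi> \<longleftrightarrow> (\<forall>x. Limsup (at x) \<phi> \<le> \<phi> x)"

definition coercive :: "('a::real_normed_vector \<Rightarrow> ereal) \<Rightarrow> bool" where
  "coercive \<phi> \<longleftrightarrow> (\<phi> \<longlongrightarrow> -\<infinity>) at_infinity"

definition Phi :: "('a::euclidean_space \<Rightarrow> ereal) set" where
  "Phi = {\<phi>. (\<forall>x. \<phi> x < \<infinity>) \<and> ext_concave \<phi> \<and> upper_semicontinuous \<phi> \<and> coercive \<phi>}"

text \<open>Integral of the positive part minus integral of the negative part (\<^const>\<open>e2ennreal\<close> sends
  negative arguments to \<open>0\<close>). The functions in \<^const>\<open>Phi\<close> are bounded above, so for them and a
  probability measure the first integral is finite and the difference is never \<open>\<infinity> - \<infinity>\<close>.\<close>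

definition ext_integral :: "'a measure \<Rightarrow> ('a \<Rightarrow> ereal) \<Rightarrow> ereal" where
  "ext_integral M f =
     enn2ereal (\<integral>\<^sup>+x. e2ennreal (f x) \<partial>M) - enn2ereal (\<integral>\<^sup>+x. e2ennreal (- f x) \<partial>M)"

definition ext_exp :: "ereal \<Rightarrow> ennreal" where
  "ext_exp x = (case x of ereal r \<Rightarrow> ennreal (exp r) | PInfty \<Rightarrow> \<infinity> | MInfty \<Rightarrow> 0)"

text \<open>For \<open>\<phi>\<close> in \<^const>\<open>Phi\<close> the integral of \<open>e\<^sup>\<phi>\<close> is finite: concavity and coercivity bound \<open>\<phi>\<close> above
  by \<open>a - b * norm x\<close> with some \<open>b > 0\<close>.\<close>

definition L_fun :: "('a::euclidean_space \<Rightarrow> ereal) \<Rightarrow> 'a measure \<Rightarrow> ereal" where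
  "L_fun \<phi> Q = ext_integral Q \<phi> - enn2ereal (\<integral>\<^sup>+x. ext_exp (\<phi> x) \<partial>lborel) + 1"

definition L_sup :: "'a::euclidean_space measure \<Rightarrow> ereal" where
  "L_sup Q = (SUP \<phi>\<in>Phi. L_fun \<phi> Q)"

definition first_moment :: "'a::euclidean_space measure \<Rightarrow> ennreal" where
  "first_moment Q = (\<integral>\<^sup>+x. ennreal (norm x) \<partial>Q)"

end

theory Submission
  imports Defs
begin

text \<open>The functional \<open>L\<close> is a supremum, so bounds from below pass to a limit easily, whereas a bound on
  \<open>limsup L(Q\<^sub>n)\<close> requires near-maximizers \<open>\<phi>\<^sub>n\<close> for \<open>Q\<^sub>n\<close> to perform almost as well for \<open>Q\<close>. The proof
  turns \<open>\<phi>\<^sub>n\<close> itself into a good competitor for \<open>Q\<close>, with errors that are uniform in \<open>\<phi>\<^sub>n\<close>.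

  The first ingredient is an a priori bound. Because the convex support of \<open>Q\<close> has interior, there are
  a centre \<open>a\<close> and constants \<open>r\<close>, \<open>\<delta>\<close> such that eventually every \<open>Q\<^sub>n\<close> gives mass at least \<open>\<delta>\<close> to every
  half-space at distance \<open>r\<close> from \<open>a\<close> (\<open>spreads_eventually\<close>). A concave \<open>\<phi>\<close> with \<open>L(\<phi>, Q\<^sub>n) \<ge> l\<close> then
  cannot be very negative anywhere on the ball around \<open>a\<close>, for it would be so on a whole half-space. This
  bounds \<open>\<phi>\<close> below on a ball; the volume of that ball and the penalty \<open>\<integral> e\<^sup>\<phi>\<close> bound the peak, and a
  volume count bounds the superlevel sets. All in all \<open>\<phi>(x) \<le> \<alpha> - \<beta> \<parallel>x\<parallel>\<close> with \<open>\<beta> > 0\<close>, where the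
  constants depend only on \<open>a\<close>, \<open>r\<close>, \<open>\<delta>\<close>, \<open>l\<close> (\<open>near_maximizer_control\<close>).

  The second ingredient is that the smallest \<open>K\<close>-Lipschitz majorant \<open>f\<close> of such a \<open>\<phi>\<close> is concave and
  costs little: \<open>\<integral> e\<^sup>f \<le> \<integral> e\<^sup>\<phi> + \<epsilon>\<close> once \<open>K\<close> is large, uniformly in \<open>\<phi>\<close> (\<open>Lipschitz_regularization\<close>).
  The comparison function is a slight dilation of \<open>\<phi>\<close> about \<open>a\<close>.

  The third ingredient is that weak convergence is uniform over functions with common bound and common
  Lipschitz constant (\<open>weakly_converges_uniform_Lipschitz\<close>). Since \<open>f + \<beta> \<parallel>x\<parallel>\<close> is bounded above by
  \<open>\<alpha>\<close>, truncating it from below gives such functions, whence, with \<open>m\<close> and \<open>m\<^sub>n\<close> the first moments,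
  \<open>L(\<phi>\<^sub>n, Q\<^sub>n) + \<beta> (m\<^sub>n - m) - \<epsilon> \<le> L(Q)\<close> for large \<open>n\<close> (\<open>near_maximizer_transfer\<close>).
  As \<open>liminf m\<^sub>n \<ge> m\<close> always, this yields \<open>limsup L(Q\<^sub>n) \<le> L(Q)\<close>; and if \<open>m\<^sub>n\<close> exceeds \<open>m\<close> by a fixed
  amount infinitely often, it yields a strict loss. Conversely, if \<open>limsup m\<^sub>n \<le> m\<close>, integrals of
  Lipschitz functions converge along \<open>Q\<^sub>n\<close>, and the Lipschitz near-maximizers for \<open>Q\<close> show
  \<open>liminf L(Q\<^sub>n) \<ge> L(Q)\<close> (\<open>L_sup_le_liminf\<close>).\<close>

section \<open>Weak convergence, uniformly over Lipschitz functions\<close>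

lemma distributionsD:
  assumes "Q \<in> distributions"
  shows "prob_space Q" "sets Q = sets borel" "space Q = UNIV"
  using assms sets_eq_imp_space_eq[of Q borel] by (auto simp: distributions_def)

lemma continuous_measurable_distribution:
  fixes f :: "'a::euclidean_space \<Rightarrow> 'b::topological_space"
  assumes "Q \<in> distributions" "continuous_on UNIV f"
  shows "f \<in> borel_measurable Q"
  using borel_measurable_continuous_onI[OF assms(2)] distributionsD(2)[OF assms(1)]
  by (simp cong: measurable_cong_sets)

lemma bounded_continuous_integrable:
  fixes f :: "'a::euclidean_space \<Rightarrow> real"
  assumes "Q \<in> distributions" "continuous_on UNIV f" "\<And>x. \<bar>f x\<bar> \<le> B"
  shows "integrable Q f"
proof -
  interpret prob_space Q using distributionsD[OF assms(1)] by simp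
  show ?thesis
    by (rule integrable_const_bound[where B=B])
       (use assms continuous_measurable_distribution in auto)
qed

lemma weakly_convergesD:
  fixes f :: "'a::euclidean_space \<Rightarrow> real"
  assumes "weakly_converges Qs Q" "continuous_on UNIV f" "\<And>x. \<bar>f x\<bar> \<le> B"
  shows "(\<lambda>n. integral\<^sup>L (Qs n) f) \<longlonglongrightarrow> integral\<^sup>L Q f"
  using assms unfolding weakly_converges_def bounded_iff by (force simp: real_norm_def)

text \<open>Replacing \<open>f\<close> by its values at the nodes \<open>x \<in> X\<close> reduces all test functions at once to the
  finitely many functions \<open>p x\<close>. The error is \<open>K \<delta>\<close> where the partition is complete; the mass it misses
  costs at most \<open>B\<close> per unit.\<close>

lemma partition_approximation:
  fixes Q :: "'a::euclidean_space measure"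
  assumes Q: "Q \<in> distributions" and X: "finite X" and \<delta>: "\<delta> > 0"
    and p: "\<And>x. x \<in> X \<Longrightarrow> continuous_on UNIV (p x)" "\<And>x z. x \<in> X \<Longrightarrow> p x z \<ge> (0::real)"
      "\<And>z. (\<Sum>x\<in>X. p x z) \<le> 1"
      "\<And>x z. x \<in> X \<Longrightarrow> p x z \<noteq> 0 \<Longrightarrow> dist x z \<le> \<delta>"
    and f: "K-lipschitz_on UNIV f" "\<And>x. \<bar>f x\<bar> \<le> B"
  shows "\<bar>(\<integral>z. f z \<partial>Q) - (\<Sum>x\<in>X. f x * (\<integral>z. p x z \<partial>Q))\<bar>
           \<le> K * \<delta> + B * (1 - (\<Sum>x\<in>X. \<integral>z. p x z \<partial>Q))"
proof -
  interpret prob_space Q using distributionsD[OF Q] by simp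
  have K: "K \<ge> 0" using f(1) by (auto simp: lipschitz_on_def)
  have B: "B \<ge> 0" using f(2)[of undefined] by linarith
  have p1: "p x z \<le> 1" if "x \<in> X" for x z
  proof -
    have "p x z \<le> (\<Sum>x\<in>X. p x z)" by (rule member_le_sum) (use that X p in auto)
    thus ?thesis using p(3)[of z] by linarith
  qed
  have ip: "integrable Q (p x)" if "x \<in> X" for x
    by (rule bounded_continuous_integrable[OF Q p(1)[OF that], where B=1])
       (use p(2)[OF that] p1[OF that] in \<open>auto simp: abs_le_iff le_minus_iff intro: order_trans\<close>)
  have if': "integrable Q f"
    by (rule bounded_continuous_integrable[OF Q lipschitz_on_continuous_on[OF f(1)], where B=B]) (rule f(2))
  have pt: "\<bar>f z - (\<Sum>x\<in>X. f x * p x z)\<bar> \<le> K * \<delta> + B * (1 - (\<Sum>x\<in>X. p x z))" for z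
  proof -
    have "f z - (\<Sum>x\<in>X. f x * p x z) = (\<Sum>x\<in>X. (f z - f x) * p x z) + f z * (1 - (\<Sum>x\<in>X. p x z))"
      by (simp add: algebra_simps sum_subtractf sum_distrib_left)
    also have "\<bar>\<dots>\<bar> \<le> \<bar>\<Sum>x\<in>X. (f z - f x) * p x z\<bar> + \<bar>f z * (1 - (\<Sum>x\<in>X. p x z))\<bar>" by (rule abs_triangle_ineq)
    also have "\<bar>f z * (1 - (\<Sum>x\<in>X. p x z))\<bar> \<le> B * (1 - (\<Sum>x\<in>X. p x z))"
      using f(2)[of z] p(3)[of z] by (auto simp: abs_mult intro!: mult_mono)
    also have "\<bar>\<Sum>x\<in>X. (f z - f x) * p x z\<bar> \<le> (\<Sum>x\<in>X. \<bar>(f z - f x) * p x z\<bar>)" by (rule sum_abs)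
    also have "\<dots> \<le> (\<Sum>x\<in>X. K * \<delta> * p x z)"
    proof (rule sum_mono)
      fix x assume x: "x \<in> X"
      show "\<bar>(f z - f x) * p x z\<bar> \<le> K * \<delta> * p x z"
      proof (cases "p x z = 0")
        case False
        have "\<bar>f z - f x\<bar> \<le> K * dist z x" using lipschitz_onD[OF f(1), of z x] by (simp add: dist_real_def)
        also have "\<dots> \<le> K * \<delta>" using p(4)[OF x False] K by (intro mult_left_mono) (auto simp: dist_commute)
        finally show ?thesis using p(2)[OF x] by (auto simp: abs_mult intro!: mult_right_mono)
      qed simp
    qed
    also have "\<dots> = K * \<delta> * (\<Sum>x\<in>X. p x z)" by (simp add: sum_distrib_left)
    also have "\<dots> \<le> K * \<delta> * 1" using p(3)[of z] K \<delta> by (intro mult_left_mono) auto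
    finally show ?thesis by simp
  qed
  have "(\<integral>z. f z \<partial>Q) - (\<Sum>x\<in>X. f x * (\<integral>z. p x z \<partial>Q)) = (\<integral>z. f z - (\<Sum>x\<in>X. f x * p x z) \<partial>Q)"
    using if' ip by (simp add: Bochner_Integration.integral_sum)
  also have "\<bar>\<dots>\<bar> \<le> (\<integral>z. \<bar>f z - (\<Sum>x\<in>X. f x * p x z)\<bar> \<partial>Q)"
    by (rule integral_abs_bound)
  also have "\<dots> \<le> (\<integral>z. K * \<delta> + B * (1 - (\<Sum>x\<in>X. p x z)) \<partial>Q)"
    using if' ip pt by (intro integral_mono) auto
  also have "\<dots> = K * \<delta> + B * (1 - (\<Sum>x\<in>X. \<integral>z. p x z \<partial>Q))"
    using ip by (simp add: Bochner_Integration.integral_sum prob_space)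
  finally show ?thesis .
qed

text \<open>Hat functions centred at a finite \<open>\<delta>/2\<close>-net of a ball that carries almost all the mass of \<open>Q\<close>,
  normalized to add up to \<open>1\<close> on that ball.\<close>

lemma exists_partition:
  fixes Q :: "'a::euclidean_space measure"
  assumes Q: "Q \<in> distributions" and \<delta>: "\<delta> > 0" and \<tau>: "\<tau> > 0"
  obtains X p where "finite X"
      "\<And>x. x \<in> X \<Longrightarrow> continuous_on UNIV (p x)" "\<And>x z. x \<in> X \<Longrightarrow> p x z \<ge> (0::real)"
      "\<And>z. (\<Sum>x\<in>X. p x z) \<le> 1"
      "\<And>x z. x \<in> X \<Longrightarrow> p x z \<noteq> 0 \<Longrightarrow> dist x z \<le> \<delta>"
      "(\<Sum>x\<in>X. \<integral>z. p x z \<partial>Q) \<ge> 1 - \<tau>"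
proof -
  interpret prob_space Q using distributionsD[OF Q] by simp
  note sQ = distributionsD(2,3)[OF Q]
  have "(\<lambda>n. measure Q (cball 0 (real n))) \<longlonglongrightarrow> measure Q (\<Union>n. cball 0 (real n))"
    by (rule finite_Lim_measure_incseq) (auto simp: sQ incseq_def)
  also have "(\<Union>n. cball 0 (real n)) = (UNIV :: 'a set)"
    by (auto intro: real_arch_simple)
  finally have "(\<lambda>n. measure Q (cball 0 (real n))) \<longlonglongrightarrow> 1" using prob_space sQ by simp
  from order_tendstoD(1)[OF this, of "1 - \<tau>"] \<tau> obtain n where n: "measure Q (cball 0 (real n)) > 1 - \<tau>"
    by (auto simp: eventually_sequentially)
  have "compact (cball 0 (real n) :: 'a set)" by simp
  then obtain X where X: "finite X" "cball 0 (real n) \<subseteq> (\<Union>x\<in>X. ball x (\<delta>/2 :: real) :: 'a set)"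
    unfolding compact_eq_totally_bounded using \<delta> by (meson half_gt_zero)
  define h where "h x z = max 0 (\<delta> - dist x z)" for x z :: 'a
  define S where "S z = (\<Sum>x\<in>X. h x z)" for z
  \<comment> \<open>On the ball \<open>S \<ge> \<delta>/2\<close>, so there the quotient is a partition of unity; the maximum keeps it
    continuous elsewhere.\<close>
  define p where "p x z = h x z / max (S z) (\<delta>/2)" for x z
  have hc: "continuous_on UNIV (h x)" for x unfolding h_def by (intro continuous_intros)
  have Sc: "continuous_on UNIV S" unfolding S_def by (intro continuous_intros hc)
  have m: "max (S z) (\<delta>/2) > 0" for z using \<delta> by (simp add: less_max_iff_disj)
  have pc: "continuous_on UNIV (p x)" for x unfolding p_def
    by (intro continuous_intros hc Sc) (use m less_irrefl in metis)
  have p0: "p x z \<ge> 0" for x z unfolding p_def using m[of z] by (auto simp: h_def)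
  have ps: "(\<Sum>x\<in>X. p x z) = S z / max (S z) (\<delta>/2)" for z
    by (simp add: p_def S_def sum_divide_distrib)
  have ps1: "(\<Sum>x\<in>X. p x z) \<le> 1" for z
    unfolding ps using m[of z] by (subst divide_le_eq_1_pos) auto
  have pd: "dist x z \<le> \<delta>" if "p x z \<noteq> 0" for x z
    using that by (auto simp: p_def h_def max_def split: if_splits)
  have in1: "(\<Sum>x\<in>X. p x z) = 1" if z: "z \<in> cball 0 (real n)" for z
  proof -
    from X z obtain x where x: "x \<in> X" "dist x z < \<delta>/2" by auto
    have "\<delta>/2 \<le> h x z" using x unfolding h_def by linarith
    also have "h x z \<le> S z" unfolding S_def by (rule member_le_sum) (use x X in \<open>auto simp: h_def\<close>)
    finally show ?thesis unfolding ps using m[of z] by (simp add: max_absorb1)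
  qed
  have p1: "\<bar>p x z\<bar> \<le> 1" if "x \<in> X" for x z
  proof -
    have "p x z \<le> (\<Sum>x\<in>X. p x z)" by (rule member_le_sum) (use that X p0 in auto)
    thus ?thesis using ps1[of z] p0[of x z] by linarith
  qed
  have ip: "integrable Q (p x)" if "x \<in> X" for x
    by (rule bounded_continuous_integrable[OF Q pc p1[OF that]])
  have iball: "integrable Q (indicator (cball 0 (real n)) :: 'a \<Rightarrow> real)"
    by (intro integrable_real_indicator) (auto simp: sQ emeasure_eq_measure)
  have "measure Q (cball 0 (real n)) = (\<integral>z. indicator (cball 0 (real n)) z \<partial>Q)" by (simp add: sQ)
  also have "\<dots> \<le> (\<integral>z. (\<Sum>x\<in>X. p x z) \<partial>Q)"
    by (rule integral_mono[OF iball]) (use in1 ip p0 in \<open>auto simp: indicator_def sum_nonneg\<close>)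
  also have "\<dots> = (\<Sum>x\<in>X. \<integral>z. p x z \<partial>Q)" using ip by (simp add: Bochner_Integration.integral_sum)
  finally show ?thesis using n X(1) pc p0 ps1 pd that[of X p] by auto
qed

text \<open>A partition of unity fixed by \<open>Q\<close> alone serves all \<open>f\<close> simultaneously. It captures almost all of
  the mass of \<open>Q\<^sub>n\<close> too, because the integrals of its finitely many members converge.\<close>

lemma weakly_converges_uniform_Lipschitz:
  fixes Qs :: "nat \<Rightarrow> 'a::euclidean_space measure"
  assumes Qs: "\<And>n. Qs n \<in> distributions" and Q: "Q \<in> distributions"
    and w: "weakly_converges Qs Q" and \<epsilon>: "\<epsilon> > 0"
  shows "\<forall>\<^sub>F n in sequentially. \<forall>f::'a \<Rightarrow> real. K-lipschitz_on UNIV f \<longrightarrow> (\<forall>x. \<bar>f x\<bar> \<le> B) \<longrightarrow>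
           \<bar>integral\<^sup>L (Qs n) f - integral\<^sup>L Q f\<bar> \<le> \<epsilon>"
proof (cases "K \<ge> 0 \<and> B \<ge> 0")
  case False
  have "\<not> (K-lipschitz_on UNIV f \<and> (\<forall>x. \<bar>f x\<bar> \<le> B))" for f :: "'a \<Rightarrow> real"
    using False by (smt (verit) lipschitz_on_def)
  thus ?thesis by (intro always_eventually) blast
next
  case True
  hence K: "K \<ge> 0" and B: "B \<ge> 0" by auto
  \<comment> \<open>The final bound is \<open>2 K \<delta> + 4 B \<tau>\<close>: one approximation error for each distribution, with missed mass
    at most \<open>2 \<tau>\<close> for \<open>Q\<^sub>n\<close> and \<open>\<tau>\<close> for \<open>Q\<close>, and at most \<open>B \<tau>\<close> for the nodes.\<close>
  define \<delta> where "\<delta> = \<epsilon> / (6 * (K + 1))"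
  define \<tau> where "\<tau> = \<epsilon> / (6 * (B + 1))"
  have pos: "\<delta> > 0" "\<tau> > 0" using K B \<epsilon> by (auto simp: \<delta>_def \<tau>_def)
  have Kd: "K * \<delta> \<le> \<epsilon> / 6" unfolding \<delta>_def using K \<epsilon> by (simp add: field_simps)
  have Bt: "B * \<tau> \<le> \<epsilon> / 6" unfolding \<tau>_def using B \<epsilon> by (simp add: field_simps)
  obtain X p where p: "finite X"
      "\<And>x. x \<in> X \<Longrightarrow> continuous_on UNIV (p x)" "\<And>x z. x \<in> X \<Longrightarrow> p x z \<ge> (0::real)"
      "\<And>z. (\<Sum>x\<in>X. p x z) \<le> 1"
      "\<And>x z. x \<in> X \<Longrightarrow> p x z \<noteq> 0 \<Longrightarrow> dist x z \<le> \<delta>"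
      "(\<Sum>x\<in>X. \<integral>z. p x z \<partial>Q) \<ge> 1 - \<tau>"
    using exists_partition[OF Q pos] by metis
  have p1: "\<bar>p x z\<bar> \<le> 1" if "x \<in> X" for x z
  proof -
    have "p x z \<le> (\<Sum>x\<in>X. p x z)" by (rule member_le_sum) (use that p in auto)
    thus ?thesis using p(4)[of z] p(3)[OF that, of z] by linarith
  qed
  define D where "D n = (\<Sum>x\<in>X. \<bar>(\<integral>z. p x z \<partial>Qs n) - (\<integral>z. p x z \<partial>Q)\<bar>)" for n
  have "(\<lambda>n. \<Sum>x\<in>X. \<bar>(\<integral>z. p x z \<partial>Qs n) - (\<integral>z. p x z \<partial>Q)\<bar>)
          \<longlonglongrightarrow> (\<Sum>x\<in>X. \<bar>(\<integral>z. p x z \<partial>Q) - (\<integral>z. p x z \<partial>Q)\<bar>)"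
    by (intro tendsto_intros weakly_convergesD[OF w p(2) p1])
  hence "D \<longlonglongrightarrow> 0" unfolding D_def by simp
  from order_tendstoD(2)[OF this pos(2)]
  show ?thesis
  proof eventually_elim
    case (elim n)
    show ?case
    proof (intro allI impI)
      fix f :: "'a \<Rightarrow> real" assume f: "K-lipschitz_on UNIV f" "\<forall>x. \<bar>f x\<bar> \<le> B"
      define A where "A R = (\<Sum>x\<in>X. f x * (\<integral>z. p x z \<partial>R))" for R
      define T where "T R = (\<Sum>x\<in>X. \<integral>z. p x z \<partial>R)" for R
      have 1: "\<bar>integral\<^sup>L R f - A R\<bar> \<le> \<epsilon> / 6 + B * (1 - T R)" if "R \<in> distributions" for R
        using partition_approximation[OF that p(1) pos(1) p(2-5) f(1), of B] f(2) Kd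
        unfolding A_def T_def by fastforce
      have "T Q - T (Qs n) \<le> D n"
        unfolding T_def D_def sum_subtractf[symmetric] by (rule sum_mono) linarith
      hence "1 - T (Qs n) \<le> 2 * \<tau>" using p(6) elim unfolding T_def by linarith
      hence "B * (1 - T (Qs n)) \<le> 2 * (B * \<tau>)" using mult_left_mono[of "1 - T (Qs n)" "2 * \<tau>" B] B by simp
      moreover have "B * (1 - T Q) \<le> B * \<tau>" using p(6) B unfolding T_def by (intro mult_left_mono) auto
      moreover have "\<bar>A (Qs n) - A Q\<bar> \<le> B * D n"
      proof -
        have "A (Qs n) - A Q = (\<Sum>x\<in>X. f x * ((\<integral>z. p x z \<partial>Qs n) - (\<integral>z. p x z \<partial>Q)))"
          by (simp add: A_def sum_subtractf right_diff_distrib)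
        also have "\<bar>\<dots>\<bar> \<le> (\<Sum>x\<in>X. B * \<bar>(\<integral>z. p x z \<partial>Qs n) - (\<integral>z. p x z \<partial>Q)\<bar>)"
          by (rule order_trans[OF sum_abs sum_mono]) (use f(2) in \<open>auto simp: abs_mult intro!: mult_right_mono\<close>)
        finally show ?thesis by (simp add: D_def sum_distrib_left)
      qed
      moreover have "B * D n \<le> B * \<tau>" using elim B by (intro mult_left_mono) auto
      ultimately show "\<bar>integral\<^sup>L (Qs n) f - integral\<^sup>L Q f\<bar> \<le> \<epsilon>"
        using 1[OF Qs, of n] 1[OF Q] Bt by linarith
    qed
  qed
qed

section \<open>Half-space mass under weak convergence\<close>

text \<open>A bound on half-space depth around \<open>a\<close>. It quantifies, in a form that is stable under weak
  convergence, that the convex support has interior: each closed half-space with mass above \<open>1 - \<delta>\<close>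
  reaches beyond distance \<open>r\<close> from \<open>a\<close> along its outer normal.\<close>

definition spreads :: "'a::euclidean_space \<Rightarrow> real \<Rightarrow> real \<Rightarrow> 'a measure \<Rightarrow> bool" where
  "spreads a r \<delta> Q \<longleftrightarrow> (\<forall>u. norm u = 1 \<longrightarrow> \<delta> \<le> measure Q {z. r < u \<bullet> (z - a)})"

text \<open>A half-space of full mass is closed and convex and hence contains the convex support, so it cannot
  cut off a part of a ball inside that support. The integrand is a Lipschitz minorant of the indicator of
  the open half-space, so that weak convergence applies to it.\<close>

lemma Qo_halfspace_integral_pos:
  fixes Q :: "'a::euclidean_space measure"
  assumes Q: "Q \<in> Qo"
  obtains a r where "r > 0" "\<And>u. norm u = 1 \<Longrightarrow> 0 < (\<integral>z. min 1 (max 0 (u \<bullet> (z - a) - r)) \<partial>Q)"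
proof -
  have Qd: "Q \<in> distributions" using Q by (auto simp: Qo_def)
  interpret prob_space Q using distributionsD[OF Qd] by simp
  note sQ = distributionsD(2,3)[OF Qd]
  from Q obtain a e where e: "e > 0" "ball a e \<subseteq> csupp Q"
    by (auto simp: Qo_def) (metis mem_interior)
  show ?thesis
  proof (rule that[of "e/4"])
    show "e/4 > 0" using e by simp
    fix u :: 'a assume u: "norm u = 1"
    let ?g = "\<lambda>z. min 1 (max 0 (u \<bullet> (z - a) - e/4))"
    have c: "continuous_on UNIV ?g" by (intro continuous_intros)
    have i: "integrable Q ?g" by (rule bounded_continuous_integrable[OF Qd c, of 1]) auto
    have "0 \<le> integral\<^sup>L Q ?g" by (rule Bochner_Integration.integral_nonneg) auto
    moreover have "integral\<^sup>L Q ?g \<noteq> 0"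
    proof
      assume "integral\<^sup>L Q ?g = 0"
      hence "AE z in Q. ?g z = 0" using integral_nonneg_eq_0_iff_AE[OF i] by auto
      hence ae: "AE z in Q. z \<in> {z. u \<bullet> z \<le> u \<bullet> a + e/4}"
        by eventually_elim (auto simp: inner_diff_right min_def max_def split: if_splits)
      let ?C = "{z. u \<bullet> z \<le> u \<bullet> a + e/4}"
      have cl: "closed ?C" by (rule closed_halfspace_le)
      hence "measure Q ?C = 1" using ae by (subst prob_eq_1) (auto simp: sQ)
      hence "csupp Q \<subseteq> ?C" unfolding csupp_def using cl convex_halfspace_le[of u] by blast
      moreover have "a + (e/2) *\<^sub>R u \<in> ball a e" using u e by (simp add: dist_norm)
      ultimately have "u \<bullet> (a + (e/2) *\<^sub>R u) \<le> u \<bullet> a + e/4" using e by blast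
      thus False using u e by (simp add: inner_add_right norm_eq_1)
    qed
    ultimately show "0 < integral\<^sup>L Q ?g" by linarith
  qed
qed

text \<open>The integrals of the previous lemma depend continuously on the direction \<open>u\<close>, so they have a
  positive minimum over the unit sphere. The integrands are \<open>1\<close>-Lipschitz and bounded by \<open>1\<close> whatever \<open>u\<close>
  is, and uniform weak convergence transfers half of the minimum to \<open>Q\<^sub>n\<close>.\<close>

lemma spreads_eventually:
  fixes Qs :: "nat \<Rightarrow> 'a::euclidean_space measure"
  assumes Qs: "\<And>n. Qs n \<in> distributions" and Q: "Q \<in> Qo" and w: "weakly_converges Qs Q"
  obtains a r \<delta> where "r > 0" "\<delta> > 0" "\<delta> \<le> 1" "\<forall>\<^sub>F n in sequentially. spreads a r \<delta> (Qs n)"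
proof -
  have Qd: "Q \<in> distributions" using Q by (auto simp: Qo_def)
  obtain a r where ar: "r > 0" "\<And>u. norm u = 1 \<Longrightarrow> 0 < (\<integral>z. min 1 (max 0 (u \<bullet> (z - a) - r)) \<partial>Q)"
    using Qo_halfspace_integral_pos[OF Q] by metis
  define g where "g u z = min 1 (max 0 (u \<bullet> (z - a) - r))" for u z :: 'a
  have gc: "continuous_on UNIV (g u)" for u unfolding g_def by (intro continuous_intros)
  have g1: "\<bar>g u z\<bar> \<le> 1" for u z by (auto simp: g_def)
  interpret prob_space Q using distributionsD[OF Qd] by simp
  have "continuous_on (sphere 0 1) (\<lambda>u. integral\<^sup>L Q (g u))"
  proof (rule continuous_on_sequentiallyI)
    fix v and u :: 'a assume "v \<longlonglongrightarrow> u"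
    hence "(\<lambda>n. g (v n) z) \<longlonglongrightarrow> g u z" for z unfolding g_def by (intro tendsto_intros)
    thus "(\<lambda>n. integral\<^sup>L Q (g (v n))) \<longlonglongrightarrow> integral\<^sup>L Q (g u)"
      by (intro integral_dominated_convergence[where w="\<lambda>_. 1"])
         (use g1 continuous_measurable_distribution[OF Qd gc] in auto)
  qed
  moreover have "compact (sphere (0::'a) 1)" "sphere (0::'a) 1 \<noteq> {}" by auto
  ultimately obtain v where v: "v \<in> sphere 0 1" "\<And>u. u \<in> sphere 0 1 \<Longrightarrow> integral\<^sup>L Q (g v) \<le> integral\<^sup>L Q (g u)"
    using continuous_attains_inf by metis
  define \<delta> where "\<delta> = integral\<^sup>L Q (g v) / 2"
  have \<delta>: "\<delta> > 0" using ar(2)[of v] v(1) by (simp add: \<delta>_def g_def[abs_def])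
  have "integral\<^sup>L Q (g v) \<le> (\<integral>z. 1 \<partial>Q)"
    by (rule integral_mono) (use g1 bounded_continuous_integrable[OF Qd gc g1] in \<open>auto simp: abs_le_iff\<close>)
  hence \<delta>1: "\<delta> \<le> 1" by (simp add: \<delta>_def prob_space)
  have lip: "1-lipschitz_on UNIV (g u)" if u: "norm u = 1" for u
  proof (rule lipschitz_onI)
    fix x y :: 'a
    have "\<bar>u \<bullet> (x - a) - u \<bullet> (y - a)\<bar> = \<bar>u \<bullet> (x - y)\<bar>" by (simp add: inner_diff_right)
    also have "\<dots> \<le> dist x y" using Cauchy_Schwarz_ineq2[of u "x - y"] u by (simp add: dist_norm)
    finally show "dist (g u x) (g u y) \<le> 1 * dist x y"
      unfolding g_def dist_real_def by (auto simp: min_def max_def)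
  qed simp
  have "\<forall>\<^sub>F n in sequentially. spreads a r \<delta> (Qs n)"
    using weakly_converges_uniform_Lipschitz[OF Qs Qd w \<delta>, of 1 1]
  proof eventually_elim
    case (elim n)
    interpret Qn: prob_space "Qs n" using distributionsD[OF Qs] by simp
    note sQ = distributionsD(2,3)[OF Qs[of n]]
    show ?case unfolding spreads_def
    proof (intro allI impI)
      fix u :: 'a assume u: "norm u = 1"
      have H: "{z. r < u \<bullet> (z - a)} \<in> sets (Qs n)"
        unfolding sQ by (intro borel_open open_Collect_less continuous_intros)
      have "\<bar>integral\<^sup>L (Qs n) (g u) - integral\<^sup>L Q (g u)\<bar> \<le> \<delta>" using elim lip[OF u] g1 by blast
      moreover have "integral\<^sup>L Q (g u) \<ge> 2 * \<delta>" using v(2)[of u] u by (simp add: \<delta>_def)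
      moreover have "integral\<^sup>L (Qs n) (g u) \<le> (\<integral>z. indicator {z. r < u \<bullet> (z - a)} z \<partial>Qs n)"
        by (rule integral_mono[OF bounded_continuous_integrable[OF Qs gc g1]])
           (use H in \<open>auto simp: Qn.emeasure_eq_measure intro!: integrable_real_indicator\<close>,
            auto simp: g_def indicator_def)
      ultimately show "\<delta> \<le> measure (Qs n) {z. r < u \<bullet> (z - a)}" using H by (simp add: sQ)
    qed
  qed
  thus ?thesis using that ar(1) \<delta> \<delta>1 by blast
qed

lemma spreads_Qo:
  fixes Q :: "'a::euclidean_space measure"
  assumes "Q \<in> Qo"
  obtains a r \<delta> where "r > 0" "\<delta> > 0" "\<delta> \<le> 1" "spreads a r \<delta> Q"
proof -
  have "Q \<in> distributions" "weakly_converges (\<lambda>_. Q) Q" using assms by (auto simp: weakly_converges_def Qo_def)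
  from spreads_eventually[OF this(1) assms this(2)] show ?thesis using that by fastforce
qed

section \<open>Concave coercive functions and extended integrals\<close>

lemma upper_semicontinuous_open:
  assumes "upper_semicontinuous \<phi>" shows "open {x. \<phi> x < a}"
proof (subst open_subopen, safe)
  fix x assume x: "\<phi> x < a"
  from assms have "Limsup (at x) \<phi> < a" unfolding upper_semicontinuous_def using x le_less_trans by blast
  hence "eventually (\<lambda>y. \<phi> y < a) (at x)" by (rule Limsup_lessD)
  hence "eventually (\<lambda>y. \<phi> y < a) (nhds x)" using x by (simp add: eventually_nhds_conv_at)
  thus "\<exists>T. open T \<and> x \<in> T \<and> T \<subseteq> {x. \<phi> x < a}" by (auto simp: eventually_nhds)
qed

lemma PhiD:
  assumes "\<phi> \<in> Phi"
  shows "\<phi> x < \<infinity>" "ext_concave \<phi>" "upper_semicontinuous \<phi>" "coercive \<phi>"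
  using assms by (auto simp: Phi_def)

lemma Phi_measurable:
  fixes \<phi> :: "'a::euclidean_space \<Rightarrow> ereal"
  assumes "\<phi> \<in> Phi" shows "\<phi> \<in> borel_measurable borel"
  by (rule borel_measurableI_less) (use upper_semicontinuous_open[OF PhiD(3)[OF assms]] in auto)

text \<open>Coercivity handles the complement of a ball; on the ball, the open sets \<open>{\<phi> < n}\<close> form a cover.\<close>

lemma Phi_bounded_above:
  fixes \<phi> :: "'a::euclidean_space \<Rightarrow> ereal"
  assumes "\<phi> \<in> Phi"
  obtains B where "\<And>x. \<phi> x \<le> ereal B"
proof -
  have "eventually (\<lambda>x. \<phi> x < 0) at_infinity"
    using order_tendstoD(2)[OF PhiD(4)[OF assms, unfolded coercive_def], of 0] by simp
  then obtain R where R: "\<And>x. norm x \<ge> R \<Longrightarrow> \<phi> x < 0" by (auto simp: eventually_at_infinity)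
  let ?U = "\<lambda>n::nat. {x. \<phi> x < ereal (real n)}"
  have "cball 0 R \<subseteq> (\<Union>n. ?U n)"
  proof
    fix x
    show "x \<in> (\<Union>n. ?U n)" using PhiD(1)[OF assms, of x] less_PInf_Ex_of_nat[of "\<phi> x"] by auto
  qed
  moreover have "open (?U n)" for n by (rule upper_semicontinuous_open[OF PhiD(3)[OF assms]])
  ultimately obtain D where D: "finite D" "cball 0 R \<subseteq> (\<Union>n\<in>D. ?U n)"
    using compactE_image[OF compact_cball[of 0 R], of UNIV ?U] by (metis UNIV_I)
  show ?thesis
  proof (rule that)
    fix x
    show "\<phi> x \<le> ereal (real (Max (insert 0 D)))"
    proof (cases "norm x \<ge> R")
      case True thus ?thesis using R[of x] by (auto intro: order_trans[OF less_imp_le])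
    next
      case False
      hence "x \<in> cball 0 R" by simp
      then obtain n where n: "n \<in> D" "\<phi> x < ereal (real n)" using D(2) by blast
      have "n \<le> Max (insert 0 D)" using n(1) D(1) by (intro Max_ge) auto
      hence "ereal (real n) \<le> ereal (real (Max (insert 0 D)))" by simp
      thus ?thesis using n(2) less_imp_le order_trans by blast
    qed
  qed
qed

text \<open>Concavity for real lower bounds of the values, which avoids arithmetic with \<open>-\<infinity>\<close>.\<close>

lemma ext_concaveD:
  assumes "ext_concave \<phi>" "ereal a \<le> \<phi> x" "ereal b \<le> \<phi> y" "0 \<le> t" "t \<le> 1"
  shows "ereal ((1 - t) * a + t * b) \<le> \<phi> ((1 - t) *\<^sub>R x + t *\<^sub>R y)"
proof -
  have "ereal (1 - t) * ereal a + ereal t * ereal b \<le> ereal (1 - t) * \<phi> x + ereal t * \<phi> y"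
    using assms by (intro add_mono ereal_mult_left_mono) auto
  also have "\<dots> \<le> \<phi> ((1 - t) *\<^sub>R x + t *\<^sub>R y)"
    using assms(1,4,5) unfolding ext_concave_def by simp
  finally show ?thesis by simp
qed

lemma superlevel_convex:
  assumes "ext_concave \<phi>" shows "convex {x. ereal s \<le> \<phi> x}"
  unfolding convex_alt
proof (safe)
  fix x y and u :: real assume "ereal s \<le> \<phi> x" "ereal s \<le> \<phi> y" "0 \<le> u" "u \<le> 1"
  from ext_concaveD[OF assms this] show "ereal s \<le> \<phi> ((1 - u) *\<^sub>R x + u *\<^sub>R y)"
    by (simp add: algebra_simps)
qed

lemma ext_integral_mono:
  assumes "\<And>x. f x \<le> g x"
  shows "ext_integral M f \<le> ext_integral M g"
  unfolding ext_integral_def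
  by (intro ereal_minus_mono)
     (auto simp: less_eq_ennreal.rep_eq[symmetric] assms intro!: nn_integral_mono e2ennreal_mono)

lemma e2ennreal_ereal: "e2ennreal (ereal x) = ennreal x"
  by (simp add: ennreal.abs_eq e2ennreal_def max_def)

lemma ext_integral_real:
  assumes "integrable M f"
  shows "ext_integral M (\<lambda>x. ereal (f x)) = ereal (integral\<^sup>L M f)"
proof -
  have "(\<integral>\<^sup>+x. ennreal (f x) \<partial>M) < \<infinity>" "(\<integral>\<^sup>+x. ennreal (- f x) \<partial>M) < \<infinity>"
    using assms unfolding real_integrable_def by (auto simp: less_top)
  then obtain p q where "(\<integral>\<^sup>+x. ennreal (f x) \<partial>M) = ennreal p" "p \<ge> 0"
      "(\<integral>\<^sup>+x. ennreal (- f x) \<partial>M) = ennreal q" "q \<ge> 0"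
    by (metis ennreal_cases infinity_ennreal_def less_irrefl)
  thus ?thesis
    unfolding ext_integral_def real_lebesgue_integral_def[OF assms]
    by (simp add: e2ennreal_ereal enn2ereal_ennreal)
qed

lemma ext_exp_mono: "a \<le> b \<Longrightarrow> ext_exp a \<le> ext_exp b"
  by (cases a; cases b) (auto simp: ext_exp_def)

lemma ext_exp_real [simp]: "ext_exp (ereal r) = ennreal (exp r)"
  by (simp add: ext_exp_def)

text \<open>A lower bound on \<open>L(\<phi>, Q)\<close> makes both integrals real, so that from here on estimates are
  between real numbers.\<close>

lemma L_fun_finite:
  fixes \<phi> :: "'a::euclidean_space \<Rightarrow> ereal"
  assumes Q: "Q \<in> distributions" and B: "\<And>x. \<phi> x \<le> ereal B" and L: "ereal l \<le> L_fun \<phi> Q"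
  obtains I E where "I \<ge> 0" "(\<integral>\<^sup>+x. ext_exp (\<phi> x) \<partial>lborel) = ennreal I" "ext_integral Q \<phi> = ereal E"
     "L_fun \<phi> Q = ereal (E - I + 1)" "E \<le> B"
proof -
  interpret prob_space Q using distributionsD[OF Q] by simp
  have "ext_integral Q \<phi> \<le> ext_integral Q (\<lambda>_. ereal B)" by (rule ext_integral_mono) (rule B)
  also have "\<dots> = ereal B" by (subst ext_integral_real) (auto simp: prob_space)
  finally have EB: "ext_integral Q \<phi> \<le> ereal B" .
  show ?thesis
  proof (cases "\<integral>\<^sup>+x. ext_exp (\<phi> x) \<partial>lborel")
    case (real I)
    have "ext_integral Q \<phi> \<noteq> -\<infinity>"
    proof
      assume "ext_integral Q \<phi> = -\<infinity>"
      thus False using L real by (simp add: L_fun_def enn2ereal_ennreal)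
    qed
    with EB obtain E where E: "ext_integral Q \<phi> = ereal E" by (cases "ext_integral Q \<phi>") auto
    show ?thesis
      by (rule that[OF real(1) real(2) E]) (use E EB real in \<open>auto simp: L_fun_def enn2ereal_ennreal one_ereal_def\<close>)
  next
    case top
    have "L_fun \<phi> Q = -\<infinity>" using EB top by (cases "ext_integral Q \<phi>") (auto simp: L_fun_def)
    thus ?thesis using L by simp
  qed
qed

text \<open>If the convex set \<open>{\<phi> \<ge> s}\<close> misses a point \<open>y\<close> of the ball, a hyperplane through \<open>y\<close> bounds it, and
  the half-space beyond the ball in the direction of the normal avoids it.\<close>

lemma ball_not_superlevel:
  fixes \<phi> :: "'a::euclidean_space \<Rightarrow> ereal"
  assumes "ext_concave \<phi>" and y: "dist a y \<le> r" "\<phi> y < ereal s"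
  obtains u where "norm u = 1" "\<And>z. r < u \<bullet> (z - a) \<Longrightarrow> \<phi> z < ereal s"
proof (cases "{x. ereal s \<le> \<phi> x} = {}")
  case True
  obtain u :: 'a where "norm u = 1" using vector_choose_size[of 1] by auto
  thus ?thesis using that True by (metis (mono_tags, lifting) empty_iff mem_Collect_eq not_le)
next
  case False
  let ?S = "{x. ereal s \<le> \<phi> x}"
  have "?S \<inter> {y} = {}" using y by auto
  from separating_hyperplane_sets[OF superlevel_convex[OF assms(1)] _ False _ this]
  obtain w b where w: "w \<noteq> 0" "\<forall>x\<in>?S. w \<bullet> x \<le> b" "b \<le> w \<bullet> y" by auto
  define u where "u = w /\<^sub>R norm w"
  have u: "norm u = 1" using w by (simp add: u_def)
  show ?thesis
  proof (rule that[OF u])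
    fix z assume z: "r < u \<bullet> (z - a)"
    show "\<phi> z < ereal s"
    proof (rule ccontr)
      assume "\<not> ?thesis"
      hence "w \<bullet> z \<le> w \<bullet> y" using w(2,3) by (auto simp: not_less intro: order_trans)
      hence "u \<bullet> z \<le> u \<bullet> y" unfolding u_def using w by (simp add: divide_right_mono)
      hence "u \<bullet> (z - a) \<le> u \<bullet> (y - a)" by (simp add: inner_diff_right)
      also have "\<dots> \<le> r" using Cauchy_Schwarz_ineq2[of u "y - a"] u y by (simp add: dist_norm norm_minus_commute)
      finally show False using z by simp
    qed
  qed
qed

text \<open>A dip by \<open>T\<close> below the upper bound \<open>M\<close> anywhere in the ball forces the same dip on a half-space of
  mass \<open>\<delta>\<close> and thus lowers the integral by \<open>T \<delta>\<close>.\<close>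

lemma spreads_integral_le:
  fixes \<phi> :: "'a::euclidean_space \<Rightarrow> ereal"
  assumes Q: "Q \<in> distributions" "spreads a r \<delta> Q" and c: "ext_concave \<phi>" and M: "\<And>x. \<phi> x \<le> ereal M"
    and y: "dist a y \<le> r" "\<phi> y < ereal (M - T)" and T: "T \<ge> 0"
  shows "ext_integral Q \<phi> \<le> ereal (M - T * \<delta>)"
proof -
  interpret prob_space Q using distributionsD[OF Q(1)] by simp
  note sQ = distributionsD(2,3)[OF Q(1)]
  obtain u where u: "norm u = 1" "\<And>z. r < u \<bullet> (z - a) \<Longrightarrow> \<phi> z < ereal (M - T)"
    using ball_not_superlevel[OF c y] by metis
  let ?H = "{z. r < u \<bullet> (z - a)}"
  have H: "?H \<in> sets Q"
    unfolding sQ by (intro borel_open open_Collect_less continuous_intros)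
  have i: "integrable Q (\<lambda>z. T * indicator ?H z)" using H by (intro integrable_mult_right integrable_real_indicator) (auto simp: emeasure_eq_measure)
  have "ext_integral Q \<phi> \<le> ext_integral Q (\<lambda>z. ereal (M - T * indicator ?H z))"
  proof (rule ext_integral_mono)
    fix z show "\<phi> z \<le> ereal (M - T * indicator ?H z)"
      using M[of z] u(2)[of z] by (cases "r < u \<bullet> (z - a)") auto
  qed
  also have "\<dots> = ereal (\<integral>z. M - T * indicator ?H z \<partial>Q)"
    by (rule ext_integral_real) (use i in auto)
  also have "(\<integral>z. M - T * indicator ?H z \<partial>Q) = M - T * measure Q ?H" using i H prob_space by (simp add: sQ)
  also have "\<dots> \<le> M - T * \<delta>" using Q(2) u T unfolding spreads_def by (simp add: mult_left_mono)
  finally show ?thesis by simp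
qed

section \<open>A priori bounds for near-maximizers\<close>

lemma superlevel_volume_bound:
  assumes "S \<in> sets lborel" "\<And>x. x \<in> S \<Longrightarrow> ereal s \<le> \<phi> x"
  shows "ennreal (exp s) * emeasure lborel S \<le> (\<integral>\<^sup>+x. ext_exp (\<phi> x) \<partial>lborel)"
proof -
  have "ennreal (exp s) * emeasure lborel S = (\<integral>\<^sup>+x. ennreal (exp s) * indicator S x \<partial>lborel)"
    using assms(1) by (simp add: nn_integral_cmult_indicator)
  also have "\<dots> \<le> (\<integral>\<^sup>+x. ext_exp (\<phi> x) \<partial>lborel)"
  proof (rule nn_integral_mono)
    fix x show "ennreal (exp s) * indicator S x \<le> ext_exp (\<phi> x)"
      using ext_exp_mono[OF assms(2), of x] by (auto simp: indicator_def)
  qed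
  finally show ?thesis .
qed

text \<open>The convex hull of a ball and a point \<open>y\<close> contains the ball shrunk by \<open>t\<close> towards \<open>y\<close>; on it \<open>\<phi>\<close>
  interpolates between its bound on the ball and its value at \<open>y\<close>. The lemma is used for the volume near
  the peak, for the volume of long superlevel sets, and for the dilation that dominates the Lipschitz
  envelope.\<close>

lemma superlevel_at_cone_points:
  fixes \<phi> :: "'a::real_normed_vector \<Rightarrow> ereal"
  assumes c: "ext_concave \<phi>" and b: "\<And>x. dist a x \<le> r \<Longrightarrow> ereal s \<le> \<phi> x" and y: "ereal v \<le> \<phi> y"
    and t: "0 < t" "t \<le> 1" and x: "dist ((1 - t) *\<^sub>R y + t *\<^sub>R a) x \<le> t * r"
  shows "ereal ((1 - t) * v + t * s) \<le> \<phi> x"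
proof -
  define z where "z = (x - (1 - t) *\<^sub>R y) /\<^sub>R t"
  have xz: "x = (1 - t) *\<^sub>R y + t *\<^sub>R z" using t by (simp add: z_def)
  have "dist ((1 - t) *\<^sub>R y + t *\<^sub>R a) x = norm (t *\<^sub>R (a - z))"
    unfolding dist_norm by (subst xz) (simp add: algebra_simps)
  hence "dist a z \<le> r" using x t by (simp add: dist_norm)
  from ext_concaveD[OF c y b[OF this], of t] t show ?thesis by (simp add: xz[symmetric])
qed

lemma peak_growth_bound:
  fixes k :: real
  assumes "k > 0"
  obtains S where "\<And>s. s \<ge> 1 \<Longrightarrow> k * exp s \<le> s ^ Suc d \<Longrightarrow> s \<le> S"
proof -
  have "eventually (\<lambda>s::real. s ^ Suc d / exp s < k) at_top"
    by (rule order_tendstoD(2)[OF tendsto_power_div_exp_0 assms])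
  then obtain S where "\<And>s. s \<ge> S \<Longrightarrow> s ^ Suc d / exp s < k" by (auto simp: eventually_at_top_linorder)
  hence "s \<le> S" if "k * exp s \<le> s ^ Suc d" for s
    using that by (metis exp_gt_zero linorder_le_cases linorder_not_le pos_divide_less_eq)
  thus ?thesis using that by blast
qed

text \<open>Let \<open>M\<close> be the supremum of \<open>\<phi>\<close> and \<open>s = M + 2 - l\<close>. A dip by more than \<open>T = s / \<delta>\<close> in the ball
  would give \<open>\<integral> \<phi> dQ \<le> l - 2\<close>, too little for \<open>L(\<phi>, Q) \<ge> l\<close>. So \<open>\<phi> \<ge> M - T\<close> on the ball, and by
  concavity \<open>\<phi> \<ge> M - 3/2\<close> on a copy of the ball shrunk by \<open>1 / T\<close>. Its volume is of order \<open>s\<close> to the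
  power \<open>- d\<close>, while \<open>\<integral> e\<^sup>\<phi> \<le> M + 1 - l \<le> s\<close>. Hence the exponential of \<open>s\<close> is bounded by a constant
  multiple of \<open>s\<close> to the power \<open>d + 1\<close>, which bounds \<open>s\<close>.\<close>

lemma near_maximizer_peak_bound:
  fixes a :: "'a::euclidean_space"
  assumes r: "r > 0" and \<delta>: "\<delta> > 0" "\<delta> \<le> 1"
  obtains M0 c I0 where "\<And>Q \<phi>. Q \<in> distributions \<Longrightarrow> spreads a r \<delta> Q \<Longrightarrow> \<phi> \<in> Phi \<Longrightarrow> ereal l \<le> L_fun \<phi> Q \<Longrightarrow>
     (\<forall>x. \<phi> x \<le> ereal M0) \<and> (\<forall>x. dist a x \<le> r \<longrightarrow> ereal c \<le> \<phi> x) \<and>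
     (\<integral>\<^sup>+x. ext_exp (\<phi> x) \<partial>lborel) \<le> ennreal I0"
proof -
  let ?d = "DIM('a)"
  define \<omega> where "\<omega> = unit_ball_vol (real ?d)"
  define k where "k = exp (l - 7/2) * \<omega> * (r * \<delta>) ^ ?d"
  have \<omega>: "\<omega> > 0" by (simp add: \<omega>_def unit_ball_vol_pos)
  have "k > 0" using \<omega> r \<delta> by (simp add: k_def)
  then obtain S where S: "\<And>s. s \<ge> 1 \<Longrightarrow> k * exp s \<le> s ^ Suc ?d \<Longrightarrow> s \<le> S"
    using peak_growth_bound by metis
  show ?thesis
  proof (rule that[of "S + l - 2" "l - 1 - S/\<delta>" S])
    fix Q and \<phi> :: "'a \<Rightarrow> ereal"
    assume Q: "Q \<in> distributions" "spreads a r \<delta> Q" and \<phi>: "\<phi> \<in> Phi" and L: "ereal l \<le> L_fun \<phi> Q"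
    note conc = PhiD(2)[OF \<phi>]
    obtain B where B: "\<And>x. \<phi> x \<le> ereal B" using Phi_bounded_above[OF \<phi>] by blast
    obtain I E where IE: "I \<ge> 0" "(\<integral>\<^sup>+x. ext_exp (\<phi> x) \<partial>lborel) = ennreal I" "ext_integral Q \<phi> = ereal E"
       "L_fun \<phi> Q = ereal (E - I + 1)" using L_fun_finite[OF Q(1) B L] by metis
    have El: "l \<le> E - I + 1" using L IE by simp
    have EM: "E \<le> M" if "\<And>x. \<phi> x \<le> ereal M" for M
      using L_fun_finite[OF Q(1) that L] IE(3) by (metis ereal.inject)
    have "(SUP x. \<phi> x) \<le> ereal B" using B by (simp add: SUP_le_iff)
    moreover have "(SUP x. \<phi> x) \<noteq> -\<infinity>"
    proof
      assume "(SUP x. \<phi> x) = -\<infinity>"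
      hence "\<phi> x \<le> ereal (l - 2)" for x using SUP_upper[of x UNIV \<phi>] by simp
      from EM[OF this] El IE(1) show False by simp
    qed
    ultimately obtain M where M: "(SUP x. \<phi> x) = ereal M" by (cases "SUP x. \<phi> x") auto
    have \<phi>M: "\<phi> x \<le> ereal M" for x using SUP_upper[of x UNIV \<phi>] M by simp
    obtain x1 where x1: "ereal (M - 1/2) \<le> \<phi> x1"
      using less_SUP_iff[of "ereal (M - 1/2)" \<phi> UNIV] M by (auto intro: less_imp_le)
    have Ml: "M \<ge> l - 1" "I \<le> M + 1 - l" using EM[OF \<phi>M] El IE(1) by auto
    \<comment> \<open>\<open>T\<close> is chosen so that \<open>M - T * \<delta> = l - 2\<close>.\<close>
    define s where "s = M + 2 - l"
    define T where "T = s / \<delta>"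
    have s1: "s \<ge> 1" using Ml by (simp add: s_def)
    have T1: "T \<ge> 1" unfolding T_def using s1 \<delta> by simp
    have ball: "ereal (M - T) \<le> \<phi> x" if x: "dist a x \<le> r" for x
    proof (rule ccontr)
      assume "\<not> ?thesis"
      hence "\<phi> x < ereal (M - T)" by simp
      from spreads_integral_le[OF Q conc \<phi>M x this] T1 IE(3) have "E \<le> M - T * \<delta>" by simp
      hence "E \<le> l - 2" using \<delta> by (simp add: T_def s_def)
      thus False using El IE(1) by simp
    qed
    let ?t = "1 / T"
    let ?C = "ball ((1 - ?t) *\<^sub>R x1 + ?t *\<^sub>R a) (?t * r)"
    have "ereal (M - 3/2) \<le> \<phi> x" if "x \<in> ?C" for x
    proof -
      have "M - 3/2 \<le> (1 - ?t) * (M - 1/2) + ?t * (M - T)" using T1 by (simp add: field_simps)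
      hence "ereal (M - 3/2) \<le> ereal ((1 - ?t) * (M - 1/2) + ?t * (M - T))" by simp
      also have "\<dots> \<le> \<phi> x"
        by (rule superlevel_at_cone_points[OF conc ball x1]) (use that T1 in auto)
      finally show ?thesis .
    qed
    hence "ennreal (exp (M - 3/2)) * emeasure lborel ?C \<le> ennreal I"
      using superlevel_volume_bound[of ?C "M - 3/2" \<phi>] IE(2) by simp
    hence "exp (M - 3/2) * (\<omega> * (?t * r) ^ ?d) \<le> I" using T1 r \<omega> IE(1)
      by (simp add: emeasure_ball \<omega>_def ennreal_mult[symmetric])
    also have "I \<le> s" using Ml by (simp add: s_def)
    also have "exp (M - 3/2) * (\<omega> * (?t * r) ^ ?d) = k * exp s / s ^ ?d"
      using \<delta> s1 by (simp add: k_def s_def T_def exp_add[symmetric] power_divide power_mult_distrib exp_diff field_simps)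
    finally have "k * exp s \<le> s ^ Suc ?d" using s1 by (simp add: field_simps)
    from S[OF s1 this] have sS: "s \<le> S" .
    have "l - 1 - S/\<delta> \<le> M - T" using Ml sS \<delta> unfolding T_def by (simp add: divide_right_mono add_increasing diff_mono)
    hence "ereal (l - 1 - S/\<delta>) \<le> \<phi> x" if "dist a x \<le> r" for x
      using ball[OF that] by (meson ereal_less_eq(3) order_trans)
    moreover have "\<phi> x \<le> ereal (S + l - 2)" for x
      using order_trans[OF \<phi>M[of x], of "ereal (S + l - 2)"] sS by (simp add: s_def)
    moreover have "ennreal I \<le> ennreal S" using Ml sS by (intro ennreal_leI) (simp add: s_def)
    ultimately show "(\<forall>x. \<phi> x \<le> ereal (S + l - 2)) \<and> (\<forall>x. dist a x \<le> r \<longrightarrow> ereal (l - 1 - S/\<delta>) \<le> \<phi> x) \<and>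
       (\<integral>\<^sup>+x. ext_exp (\<phi> x) \<partial>lborel) \<le> ennreal S" using IE(2) by simp
  qed
qed

text \<open>If \<open>\<phi>(y) \<ge> c - 1\<close> at a point \<open>y\<close> far from \<open>a\<close>, then \<open>\<phi> \<ge> c - 1\<close> on the convex hull of the ball and
  \<open>y\<close>. Its half next to the ball contains many disjoint balls of radius \<open>r/2\<close>, whose total volume is too
  large for \<open>\<integral> e\<^sup>\<phi> \<le> I0\<close>.\<close>

lemma superlevel_bounded:
  fixes a :: "'a::euclidean_space"
  assumes r: "r > 0"
  obtains R where "R > 0" "\<And>\<phi> x. ext_concave \<phi> \<Longrightarrow> (\<And>x. dist a x \<le> r \<Longrightarrow> ereal c \<le> \<phi> x) \<Longrightarrow>
     (\<integral>\<^sup>+x. ext_exp (\<phi> x) \<partial>lborel) \<le> ennreal I0 \<Longrightarrow> R \<le> dist a x \<Longrightarrow> \<phi> x < ereal (c - 1)"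
proof -
  let ?d = "DIM('a)"
  define v where "v = unit_ball_vol (real ?d) * (r/2) ^ ?d"
  have v: "v > 0" using r by (simp add: v_def unit_ball_vol_pos)
  obtain k :: nat where k: "real k * (exp (c - 1) * v) > max 0 I0"
    using v reals_Archimedean3[of "exp (c - 1) * v"] by (meson exp_gt_zero mult_pos_pos)
  define R where "R = 2 * r * (real k + 1)"
  have R: "R > 0" using r by (simp add: R_def)
  show ?thesis
  proof (rule that[OF R], rule ccontr)
    fix \<phi> :: "'a \<Rightarrow> ereal" and y
    assume conc: "ext_concave \<phi>" and b: "\<And>x. dist a x \<le> r \<Longrightarrow> ereal c \<le> \<phi> x"
      and I: "(\<integral>\<^sup>+x. ext_exp (\<phi> x) \<partial>lborel) \<le> ennreal I0" and y: "R \<le> dist a y" and "\<not> \<phi> y < ereal (c - 1)"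
    hence \<phi>y: "ereal (c - 1) \<le> \<phi> y" by simp
    define D where "D = dist a y"
    have D: "D > 0" "R \<le> D" using y R by (auto simp: D_def)
    \<comment> \<open>Centres at spacing \<open>r\<close> on the first half of the segment from \<open>a\<close> to \<open>y\<close>, where the cone over the
      ball with apex \<open>y\<close> still has radius at least \<open>r/2\<close>.\<close>
    define p where "p j = (real j * r / D) *\<^sub>R y + (1 - real j * r / D) *\<^sub>R a" for j :: nat
    have half: "real j * r / D \<le> 1/2" if "j < k" for j
    proof -
      have "real j * r \<le> (real k + 1) * r" using that r by (intro mult_right_mono) auto
      hence "2 * (real j * r) \<le> R" unfolding R_def by (simp add: algebra_simps)
      thus ?thesis using D by (simp add: divide_le_eq)
    qed
    have mem: "ereal (c - 1) \<le> \<phi> x" if "j < k" "x \<in> ball (p j) (r/2)" for j x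
    proof -
      define t where "t = 1 - real j * r / D"
      have t: "t \<ge> 1/2" "t \<le> 1" using half[OF that(1)] r D by (auto simp: t_def)
      have "c - 1 \<le> (1 - t) * (c - 1) + t * c" using t by (simp add: algebra_simps)
      hence "ereal (c - 1) \<le> ereal ((1 - t) * (c - 1) + t * c)" by simp
      also have "\<dots> \<le> \<phi> x"
      proof (rule superlevel_at_cone_points[OF conc b \<phi>y])
        have "dist ((1 - t) *\<^sub>R y + t *\<^sub>R a) x \<le> (1/2) * r" using that(2) by (simp add: p_def t_def)
        also have "\<dots> \<le> t * r" using t r by (intro mult_right_mono) auto
        finally show "dist ((1 - t) *\<^sub>R y + t *\<^sub>R a) x \<le> t * r" .
      qed (use t in auto)
      finally show ?thesis .
    qed
    have dist_p: "dist (p i) (p j) = \<bar>real i - real j\<bar> * r" for i j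
    proof -
      have "p i - p j = ((real i - real j) * r / D) *\<^sub>R (y - a)"
        by (simp add: p_def algebra_simps diff_divide_distrib)
      thus ?thesis using D r by (simp add: dist_norm D_def norm_minus_commute abs_mult)
    qed
    have disj: "disjoint_family_on (\<lambda>j. ball (p j) (r/2)) {..<k}"
      unfolding disjoint_family_on_def
    proof (intro ballI impI)
      fix i j :: nat assume "i \<noteq> j"
      hence "1 \<le> \<bar>real i - real j\<bar>" by linarith
      hence "r \<le> dist (p i) (p j)" unfolding dist_p using r by simp
      thus "ball (p i) (r/2) \<inter> ball (p j) (r/2) = {}" by (intro disjoint_ballI) simp
    qed
    let ?U = "\<Union>j\<in>{..<k}. ball (p j) (r/2)"
    have "emeasure lborel ?U = (\<Sum>j<k. emeasure lborel (ball (p j) (r/2)))"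
      by (rule sum_emeasure[symmetric]) (use disj in auto)
    also have "\<dots> = (\<Sum>j<k. ennreal v)" using r by (simp add: emeasure_ball v_def)
    also have "\<dots> = ennreal (real k * v)" using v by (simp add: ennreal_mult ennreal_of_nat_eq_real_of_nat)
    finally have vol: "emeasure lborel ?U = ennreal (real k * v)" .
    have "?U \<in> sets lborel" by auto
    from superlevel_volume_bound[OF this, of "c - 1" \<phi>] mem
    have "ennreal (exp (c - 1)) * ennreal (real k * v) \<le> ennreal I0" using I vol by force
    hence "ennreal (real k * (exp (c - 1) * v)) \<le> ennreal I0"
      using v by (simp add: ennreal_mult[symmetric] mult_ac)
    thus False using k by (auto simp: ennreal_le_iff2)
  qed
qed

text \<open>On the ray from \<open>a\<close> through \<open>x\<close>, the function has lost \<open>1\<close> at distance \<open>R\<close>, and by concavity it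
  keeps losing at least at that rate.\<close>

lemma concave_linear_decay:
  fixes \<phi> :: "'a::real_normed_vector \<Rightarrow> ereal"
  assumes c: "ext_concave \<phi>" and a: "ereal c \<le> \<phi> a" and R: "R > 0"
    and out: "\<And>x. R \<le> dist a x \<Longrightarrow> \<phi> x < ereal (c - 1)" and x: "R \<le> dist a x"
  shows "\<phi> x \<le> ereal (c - dist a x / R)"
proof (cases "\<phi> x")
  case (real v)
  define t where "t = R / dist a x"
  have d0: "dist a x > 0" using R x by linarith
  have t: "0 < t" "t \<le> 1" unfolding t_def using d0 R x by auto
  have "dist a ((1 - t) *\<^sub>R a + t *\<^sub>R x) = norm (t *\<^sub>R (a - x))"
    by (simp add: dist_norm algebra_simps)
  hence "R \<le> dist a ((1 - t) *\<^sub>R a + t *\<^sub>R x)" using t d0 by (simp add: t_def dist_norm)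
  from out[OF this] have "\<phi> ((1 - t) *\<^sub>R a + t *\<^sub>R x) < ereal (c - 1)" .
  moreover have "ereal ((1 - t) * c + t * v) \<le> \<phi> ((1 - t) *\<^sub>R a + t *\<^sub>R x)"
    using ext_concaveD[OF c a, of v x t] real t by simp
  ultimately have "ereal ((1 - t) * c + t * v) < ereal (c - 1)" by (rule le_less_trans[rotated])
  hence "t * v < t * c - 1" by (simp add: algebra_simps)
  hence "v < c - 1/t" using t by (simp add: field_simps)
  thus ?thesis using real by (simp add: t_def)
next
  case PInf thus ?thesis using out[OF x] by simp
qed simp

text \<open>The properties shared by all near-maximizers of all nearby distributions. They are what the Lipschitz
  regularization needs in order to be uniform.\<close>

definition controlled :: "real \<Rightarrow> real \<Rightarrow> 'a::euclidean_space \<Rightarrow> real \<Rightarrow> real \<Rightarrow> real \<Rightarrow> ('a \<Rightarrow> ereal) \<Rightarrow> bool" where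
  "controlled \<alpha> \<beta> a r c I0 \<phi> \<longleftrightarrow>
     (\<forall>x. \<phi> x \<le> ereal (\<alpha> - \<beta> * norm x)) \<and> (\<forall>x. dist a x \<le> r \<longrightarrow> ereal c \<le> \<phi> x) \<and>
     (\<integral>\<^sup>+x. ext_exp (\<phi> x) \<partial>lborel) \<le> ennreal I0"

text \<open>The point of the order of quantifiers: \<open>\<alpha>\<close>, \<open>\<beta>\<close>, \<open>c\<close>, \<open>I0\<close> depend on \<open>Q\<close> only through \<open>a\<close>, \<open>r\<close>, \<open>\<delta>\<close>,
  and so serve a whole weakly convergent sequence.\<close>

lemma near_maximizer_control:
  fixes a :: "'a::euclidean_space"
  assumes r: "r > 0" and \<delta>: "\<delta> > 0" "\<delta> \<le> 1"
  obtains \<alpha> \<beta> c I0 where "\<beta> > 0"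
    "\<And>Q \<phi>. Q \<in> distributions \<Longrightarrow> spreads a r \<delta> Q \<Longrightarrow> \<phi> \<in> Phi \<Longrightarrow> ereal l \<le> L_fun \<phi> Q \<Longrightarrow>
       controlled \<alpha> \<beta> a r c I0 \<phi>"
proof -
  obtain M0 c I0 where 1: "\<And>Q \<phi>. Q \<in> distributions \<Longrightarrow> spreads a r \<delta> Q \<Longrightarrow> \<phi> \<in> Phi \<Longrightarrow> ereal l \<le> L_fun \<phi> Q \<Longrightarrow>
     (\<forall>x. \<phi> x \<le> ereal M0) \<and> (\<forall>x. dist a x \<le> r \<longrightarrow> ereal c \<le> \<phi> x) \<and>
     (\<integral>\<^sup>+x. ext_exp (\<phi> x) \<partial>lborel) \<le> ennreal I0"
    using near_maximizer_peak_bound[OF r \<delta>] by metis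
  obtain R where R: "R > 0" "\<And>\<phi> x. ext_concave \<phi> \<Longrightarrow> (\<And>x. dist a x \<le> r \<Longrightarrow> ereal c \<le> \<phi> x) \<Longrightarrow>
     (\<integral>\<^sup>+x. ext_exp (\<phi> x) \<partial>lborel) \<le> ennreal I0 \<Longrightarrow> R \<le> dist a x \<Longrightarrow> \<phi> x < ereal (c - 1)"
    using superlevel_bounded[OF r, of a c I0] by blast
  define \<alpha> where "\<alpha> = max c M0 + norm a / R + 1"
  show ?thesis
  proof (rule that[of "1/R" \<alpha> c I0])
    fix Q and \<phi> :: "'a \<Rightarrow> ereal"
    assume as: "Q \<in> distributions" "spreads a r \<delta> Q" "\<phi> \<in> Phi" "ereal l \<le> L_fun \<phi> Q"
    note b = 1[OF as] and conc = PhiD(2)[OF as(3)]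
    have out: "\<phi> x < ereal (c - 1)" if "R \<le> dist a x" for x
      by (rule R(2)[OF conc _ _ that]) (use b in auto)
    have "\<phi> x \<le> ereal (\<alpha> - 1/R * norm x)" for x
    proof (cases "R \<le> dist a x")
      case True
      have "norm x \<le> dist a x + norm a" using norm_triangle_sub[of x a] by (simp add: dist_norm norm_minus_commute)
      hence "norm x / R \<le> dist a x / R + norm a / R" using R(1) by (simp add: divide_right_mono add_divide_distrib[symmetric])
      hence le: "ereal (c - dist a x / R) \<le> ereal (\<alpha> - 1/R * norm x)" by (simp add: \<alpha>_def)
      have "ereal c \<le> \<phi> a" using b r by simp
      from concave_linear_decay[OF conc this R(1) out True] le show ?thesis by (rule order_trans)
    next
      case False
      hence "norm x \<le> R + norm a" using norm_triangle_sub[of x a] by (simp add: dist_norm norm_minus_commute)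
      hence "norm x / R \<le> (R + norm a) / R" using R(1) by (intro divide_right_mono) auto
      also have "\<dots> = 1 + norm a / R" using R(1) by (simp add: add_divide_distrib)
      finally have "ereal M0 \<le> ereal (\<alpha> - 1/R * norm x)" by (simp add: \<alpha>_def)
      thus ?thesis using b order_trans by blast
    qed
    thus "controlled \<alpha> (1/R) a r c I0 \<phi>" using b by (simp add: controlled_def)
  qed (use R in simp)
qed

section \<open>Lipschitz regularization\<close>

lemma ext_exp_measurable: "ext_exp \<in> borel_measurable borel"
proof -
  have *: "ext_exp = (\<lambda>x. if x = \<infinity> then \<infinity> else if x = -\<infinity> then 0 else ennreal (exp (real_of_ereal x)))"
    by (rule ext, case_tac x) (auto simp: ext_exp_def)
  show ?thesis unfolding * by measurable
qed

text \<open>Half of the exponential decay absorbs the power; the other half leaves a geometric series.\<close>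

lemma summable_exp_shells:
  fixes \<beta> :: real
  assumes "\<beta> > 0"
  shows "summable (\<lambda>k::nat. exp (- \<beta> * real k) * (real k + 1) ^ d)"
proof (rule summable_comparison_test_ev)
  have "filterlim (\<lambda>k::nat. \<beta>/2 * (real k + 1)) at_top sequentially"
    using filterlim_tendsto_pos_mult_at_top[OF tendsto_const[of "\<beta>/2"] _
      filterlim_compose[OF filterlim_real_sequentially filterlim_Suc]] assms by (simp add: add.commute)
  from filterlim_compose[OF tendsto_power_div_exp_0 this, of d]
  have "eventually (\<lambda>k::nat. (\<beta>/2 * (real k + 1)) ^ d / exp (\<beta>/2 * (real k + 1)) < 1) sequentially"
    by (rule order_tendstoD) simp
  thus "\<forall>\<^sub>F k in sequentially. norm (exp (- \<beta> * real k) * (real k + 1) ^ d) \<le> ((2/\<beta>) ^ d * exp (\<beta>/2)) * exp (- \<beta>/2) ^ k"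
  proof eventually_elim
    case (elim k)
    hence "(\<beta>/2 * (real k + 1)) ^ d \<le> exp (\<beta>/2 * (real k + 1))" by simp
    hence "(2/\<beta>)^d * (\<beta>/2 * (real k + 1)) ^ d \<le> (2/\<beta>)^d * exp (\<beta>/2 * (real k + 1))"
      using assms by (intro mult_left_mono) auto
    also have "(2/\<beta>)^d * (\<beta>/2 * (real k + 1)) ^ d = (real k + 1) ^ d"
    proof -
      have "2/\<beta> * (\<beta>/2 * (real k + 1)) = real k + 1" using assms by simp
      thus ?thesis by (metis power_mult_distrib)
    qed
    finally have "exp (- \<beta> * real k) * (real k + 1) ^ d \<le> exp (- \<beta> * real k) * ((2/\<beta>)^d * exp (\<beta>/2 * (real k + 1)))"
      by (intro mult_left_mono) auto
    also have "\<dots> = (2/\<beta>)^d * exp (\<beta>/2) * exp (- \<beta>/2) ^ k"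
      by (simp add: exp_of_nat_mult[symmetric] exp_add[symmetric] field_simps)
    finally show ?case by simp
  qed
  show "summable (\<lambda>k. ((2/\<beta>) ^ d * exp (\<beta>/2)) * exp (- \<beta>/2) ^ k)"
    using assms by (intro summable_mult summable_geometric) simp
qed

text \<open>On the shell \<open>k \<le> \<parallel>x\<parallel> < k + 1\<close> the integrand is at most its value at radius \<open>k\<close>, and the shell is
  contained in a ball of radius \<open>k + 1\<close>.\<close>

lemma exp_minus_norm_integral_finite:
  assumes \<beta>: "\<beta> > 0"
  shows "(\<integral>\<^sup>+x. ennreal (exp (\<alpha> - \<beta> * norm (x::'a::euclidean_space))) \<partial>lborel) < \<infinity>"
proof -
  let ?g = "\<lambda>k x. ennreal (exp (\<alpha> - \<beta> * real k)) * indicator (ball (0::'a) (real k + 1)) x"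
  have "ennreal (exp (\<alpha> - \<beta> * norm x)) \<le> (\<Sum>k. ?g k x)" for x
  proof -
    define k where "k = nat \<lfloor>norm x\<rfloor>"
    have k: "real k \<le> norm x" "norm x < real k + 1" by (auto simp: k_def)
    have "ennreal (exp (\<alpha> - \<beta> * norm x)) \<le> ?g k x" using k \<beta> by (auto intro!: ennreal_leI mult_left_mono)
    also have "?g k x = (\<Sum>i\<in>{k}. ?g i x)"
      by (simp only: sum.insert finite.emptyI empty_iff sum.empty add_0_right not_False_eq_True)
    also have "\<dots> \<le> (\<Sum>k. ?g k x)" by (rule sum_le_suminf) auto
    finally show ?thesis .
  qed
  hence "(\<integral>\<^sup>+x. ennreal (exp (\<alpha> - \<beta> * norm (x::'a))) \<partial>lborel) \<le> (\<integral>\<^sup>+x. (\<Sum>k. ?g k x) \<partial>lborel)"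
    by (rule nn_integral_mono)
  also have "\<dots> = (\<Sum>k. \<integral>\<^sup>+x. ?g k x \<partial>lborel)" 
    by (intro nn_integral_suminf borel_measurable_times_ennreal borel_measurable_const borel_measurable_indicator) simp
  also have "\<dots> = (\<Sum>k. ennreal (exp \<alpha> * unit_ball_vol (real DIM('a)) * (exp (- \<beta> * real k) * (real k + 1) ^ DIM('a))))"
  proof (intro arg_cong[where f=suminf] ext)
    fix k :: nat
    have "(\<integral>\<^sup>+x. ?g k x \<partial>lborel) = ennreal (exp (\<alpha> - \<beta> * real k)) * emeasure lborel (ball (0::'a) (real k + 1))"
      by (rule nn_integral_cmult_indicator) simp
    also have "\<dots> = ennreal (exp (\<alpha> - \<beta> * real k) * (unit_ball_vol (real DIM('a)) * (real k + 1) ^ DIM('a)))"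
      by (simp add: emeasure_ball ennreal_mult[symmetric] unit_ball_vol_nonneg)
    also have "exp (\<alpha> - \<beta> * real k) * (unit_ball_vol (real DIM('a)) * (real k + 1) ^ DIM('a)) =
        exp \<alpha> * unit_ball_vol (real DIM('a)) * (exp (- \<beta> * real k) * (real k + 1) ^ DIM('a))"
      by (simp add: exp_diff exp_minus field_simps)
    finally show "(\<integral>\<^sup>+x. ?g k x \<partial>lborel) =
        ennreal (exp \<alpha> * unit_ball_vol (real DIM('a)) * (exp (- \<beta> * real k) * (real k + 1) ^ DIM('a)))" .
  qed
  also have "\<dots> < top"
    unfolding less_top[symmetric]
    by (rule ennreal_suminf_neq_top[OF summable_mult[OF summable_exp_shells[OF \<beta>]]]) (simp add: unit_ball_vol_nonneg)
  finally show ?thesis by simp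
qed

lemma nn_integral_dilation:
  fixes g :: "'a::euclidean_space \<Rightarrow> ennreal"
  assumes g: "g \<in> borel_measurable borel" and s: "s > 0"
  shows "(\<integral>\<^sup>+x. g (a + (x - a) /\<^sub>R s) \<partial>lborel) = ennreal (s ^ DIM('a)) * (\<integral>\<^sup>+x. g x \<partial>lborel)"
proof -
  let ?T = "\<lambda>x. (a - s *\<^sub>R a) + s *\<^sub>R x"
  have [measurable]: "g \<in> borel_measurable borel" by fact
  have "(\<integral>\<^sup>+x. g (a + (x - a) /\<^sub>R s) \<partial>lborel) =
      (\<integral>\<^sup>+x. g (a + (x - a) /\<^sub>R s) \<partial>density (distr lborel borel ?T) (\<lambda>_. ennreal (\<bar>s\<bar> ^ DIM('a))))"
    using lborel_affine[of s "a - s *\<^sub>R a"] s by simp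
  also have "\<dots> = (\<integral>\<^sup>+x. ennreal (s ^ DIM('a)) * g (a + (?T x - a) /\<^sub>R s) \<partial>lborel)"
    using s by (simp add: nn_integral_density nn_integral_distr)
  also have "\<dots> = (\<integral>\<^sup>+x. ennreal (s ^ DIM('a)) * g x \<partial>lborel)"
    using s by (intro nn_integral_cong) (simp add: scaleR_diff_right[symmetric])
  finally show ?thesis by (simp add: nn_integral_cmult)
qed

text \<open>The smallest \<open>K\<close>-Lipschitz majorant of \<open>\<phi>\<close> (the Pasch-Hausdorff envelope, or sup-convolution with
  \<open>- K \<parallel>x\<parallel>\<close>). The supremum ranges over points where \<open>\<phi>\<close> is real, so that it is taken in the reals.\<close>

definition lipschitz_envelope :: "real \<Rightarrow> ('a::metric_space \<Rightarrow> ereal) \<Rightarrow> 'a \<Rightarrow> real" where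
  "lipschitz_envelope K \<phi> x = Sup {v - K * dist x y | y v. \<phi> y = ereal v}"

context
  fixes \<phi> :: "'a::euclidean_space \<Rightarrow> ereal" and \<alpha> \<beta> K c :: real and a :: 'a
  assumes \<beta>: "0 \<le> \<beta>" "\<beta> \<le> K"
    and ub: "\<And>x. \<phi> x \<le> ereal (\<alpha> - \<beta> * norm x)" and lb: "ereal c \<le> \<phi> a"
begin

lemma envelope_term_le:
  assumes "\<phi> y = ereal v"
  shows "v - K * dist x y \<le> \<alpha> - \<beta> * norm x - (K - \<beta>) * dist x y"
proof -
  have "v \<le> \<alpha> - \<beta> * norm y" using ub[of y] assms by simp
  moreover have "norm x \<le> norm y + dist x y" using norm_triangle_sub[of x y] by (simp add: dist_norm)
  hence "\<beta> * norm x \<le> \<beta> * (norm y + dist x y)" using \<beta> by (intro mult_left_mono) auto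
  ultimately show ?thesis by (simp add: algebra_simps)
qed

lemma envelope_term_le_linear:
  assumes "\<phi> y = ereal v"
  shows "v - K * dist x y \<le> \<alpha> - \<beta> * norm x"
proof -
  have "(K - \<beta>) * dist x y \<ge> 0" using \<beta> by simp
  thus ?thesis using envelope_term_le[OF assms, of x] by linarith
qed

lemma envelope_ge:
  assumes "\<phi> y = ereal v"
  shows "v - K * dist x y \<le> lipschitz_envelope K \<phi> x"
  unfolding lipschitz_envelope_def
proof (rule cSup_upper)
  show "bdd_above {v - K * dist x y | y v. \<phi> y = ereal v}"
    by (intro bdd_aboveI[where M="\<alpha> - \<beta> * norm x"]) (auto intro: envelope_term_le_linear)
qed (use assms in blast)

lemma envelope_finite_value: obtains v where "\<phi> a = ereal v" "c \<le> v"
  using lb ub[of a] by (cases "\<phi> a") auto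

lemma envelope_le:
  assumes "\<And>y v. \<phi> y = ereal v \<Longrightarrow> v - K * dist x y \<le> b"
  shows "lipschitz_envelope K \<phi> x \<le> b"
  unfolding lipschitz_envelope_def
  by (rule cSup_least) (use assms envelope_finite_value in blast)+

lemma envelope_upper: "lipschitz_envelope K \<phi> x \<le> \<alpha> - \<beta> * norm x"
  by (rule envelope_le) (rule envelope_term_le_linear)

lemma envelope_majorizes: "\<phi> x \<le> ereal (lipschitz_envelope K \<phi> x)"
  using envelope_ge[of x _ x] ub[of x] by (cases "\<phi> x") auto

lemma envelope_lower: "c \<le> lipschitz_envelope K \<phi> a"
  using envelope_majorizes[of a] lb by (metis ereal_less_eq(3) order_trans)

lemma envelope_lipschitz: "K-lipschitz_on UNIV (lipschitz_envelope K \<phi>)"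
proof (rule lipschitz_onI)
  have *: "lipschitz_envelope K \<phi> x \<le> lipschitz_envelope K \<phi> z + K * dist x z" for x z
  proof (rule envelope_le)
    fix y v assume y: "\<phi> y = ereal v"
    have "K * dist z y \<le> K * (dist x z + dist x y)"
      using \<beta> by (intro mult_left_mono) (auto intro: dist_triangle3)
    thus "v - K * dist x y \<le> lipschitz_envelope K \<phi> z + K * dist x z"
      using envelope_ge[OF y, of z] by (simp add: algebra_simps)
  qed
  fix x z
  show "dist (lipschitz_envelope K \<phi> x) (lipschitz_envelope K \<phi> z) \<le> K * dist x z"
    using *[of x z] *[of z x] by (simp add: dist_real_def dist_commute abs_le_iff)
qed (use \<beta> in simp)

text \<open>The sup-convolution of two concave functions is concave: near-optimal \<open>p\<close> for \<open>x\<close> and \<open>q\<close> for \<open>y\<close>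
  combine to the competitor \<open>s p + t q\<close> for \<open>s x + t y\<close>.\<close>

lemma envelope_concave:
  assumes "ext_concave \<phi>" and st: "0 \<le> s" "0 \<le> t" "s + t = 1"
  shows "s * lipschitz_envelope K \<phi> x + t * lipschitz_envelope K \<phi> y
           \<le> lipschitz_envelope K \<phi> (s *\<^sub>R x + t *\<^sub>R y)"
proof (cases "s = 0 \<or> t = 0")
  case True thus ?thesis using st by auto
next
  case False
  hence pos: "s > 0" "t > 0" using st by auto
  let ?F = "lipschitz_envelope K \<phi> (s *\<^sub>R x + t *\<^sub>R y)"
  have *: "s * (v - K * dist x p) + t * (w - K * dist y q) \<le> ?F" if "\<phi> p = ereal v" "\<phi> q = ereal w" for p v q w
  proof -
    let ?m = "s *\<^sub>R p + t *\<^sub>R q"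
    have "ereal s * \<phi> p + ereal t * \<phi> q \<le> \<phi> ?m"
      using assms unfolding ext_concave_def by blast
    hence le: "ereal (s * v + t * w) \<le> \<phi> ?m" using that by simp
    then obtain m where m: "\<phi> ?m = ereal m" using ub[of ?m] by (cases "\<phi> ?m") auto
    have "dist (s *\<^sub>R x + t *\<^sub>R y) ?m = norm (s *\<^sub>R (x - p) + t *\<^sub>R (y - q))"
      by (simp add: dist_norm algebra_simps)
    also have "\<dots> \<le> s * dist x p + t * dist y q"
      using norm_triangle_ineq[of "s *\<^sub>R (x - p)" "t *\<^sub>R (y - q)"] st by (simp add: dist_norm)
    finally have "K * dist (s *\<^sub>R x + t *\<^sub>R y) ?m \<le> K * (s * dist x p + t * dist y q)"
      using \<beta> by (intro mult_left_mono) auto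
    thus ?thesis using envelope_ge[OF m, of "s *\<^sub>R x + t *\<^sub>R y"] le m by (simp add: algebra_simps)
  qed
  have "lipschitz_envelope K \<phi> y \<le> (?F - s * lipschitz_envelope K \<phi> x) / t"
  proof (rule envelope_le)
    fix q w assume q: "\<phi> q = ereal w"
    have "lipschitz_envelope K \<phi> x \<le> (?F - t * (w - K * dist y q)) / s"
      by (rule envelope_le) (use *[OF _ q] pos in \<open>simp add: field_simps\<close>)
    thus "w - K * dist y q \<le> (?F - s * lipschitz_envelope K \<phi> x) / t"
      using pos by (simp add: field_simps)
  qed
  thus ?thesis using pos by (simp add: field_simps)
qed

end

lemma Lipschitz_concave_in_Phi:
  fixes f :: "'a::euclidean_space \<Rightarrow> real"
  assumes lip: "K-lipschitz_on UNIV f" and ub: "\<And>x. f x \<le> \<alpha> - \<beta> * norm x" "\<beta> > 0"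
    and conc: "\<And>s t x y. 0 \<le> s \<Longrightarrow> 0 \<le> t \<Longrightarrow> s + t = 1 \<Longrightarrow> s * f x + t * f y \<le> f (s *\<^sub>R x + t *\<^sub>R y)"
  shows "(\<lambda>x. ereal (f x)) \<in> Phi"
proof -
  have "isCont f x" for x
    using lipschitz_on_continuous_on[OF lip] by (simp add: continuous_on_eq_continuous_at)
  hence "((\<lambda>x. ereal (f x)) \<longlongrightarrow> ereal (f x)) (at x)" for x by (simp add: isCont_def)
  hence "upper_semicontinuous (\<lambda>x. ereal (f x))" unfolding upper_semicontinuous_def
    using lim_imp_Limsup[OF at_neq_bot] by (metis order_refl)
  moreover have "coercive (\<lambda>x. ereal (f x))" unfolding coercive_def
  proof (rule tendsto_MInfty[THEN iffD2], rule allI)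
    fix r
    show "\<forall>\<^sub>F x in at_infinity. ereal (f x) < ereal r"
      unfolding eventually_at_infinity
    proof (intro exI allI impI)
      fix x :: 'a assume "(\<alpha> - r + 1) / \<beta> \<le> norm x"
      hence "\<alpha> - r + 1 \<le> \<beta> * norm x" using ub(2) by (simp add: field_simps)
      thus "ereal (f x) < ereal r" using ub(1)[of x] by simp
    qed
  qed
  moreover have "ext_concave (\<lambda>x. ereal (f x))" unfolding ext_concave_def using conc by simp
  ultimately show ?thesis by (simp add: Phi_def)
qed

text \<open>Competitors \<open>y\<close> within distance \<open>t r\<close> of \<open>x\<close> satisfy \<open>\<phi>(y) \<le> (1 + t) \<phi>(z) - t c\<close> for the point
  \<open>z = a + (x - a) / (1 + t)\<close>, since \<open>z\<close> is the convex combination of \<open>y\<close> and a point of the ball where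
  \<open>\<phi> \<ge> c\<close>. Competitors farther away lose \<open>(K - \<beta>) t r\<close> against the bound \<open>\<alpha> - \<beta> \<parallel>x\<parallel>\<close>.\<close>

lemma envelope_exp_bound:
  fixes \<phi> :: "'a::euclidean_space \<Rightarrow> ereal"
  assumes \<beta>: "0 \<le> \<beta>" "\<beta> \<le> K" and conc: "ext_concave \<phi>" 
    and ub: "\<And>x. \<phi> x \<le> ereal (\<alpha> - \<beta> * norm x)" and lb: "\<And>x. dist a x \<le> r \<Longrightarrow> ereal c \<le> \<phi> x"
    and r: "r > 0" and t: "t > 0"
  shows "ennreal (exp (lipschitz_envelope K \<phi> x)) \<le>
     ennreal (exp (t * (\<alpha> - c))) * ext_exp (\<phi> (a + (x - a) /\<^sub>R (1 + t))) +
     ennreal (exp (- (K - \<beta>) * (t * r))) * ennreal (exp (\<alpha> - \<beta> * norm x))"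
proof -
  let ?z = "a + (x - a) /\<^sub>R (1 + t)" and ?f = "lipschitz_envelope K \<phi> x"
  let ?far = "\<alpha> - \<beta> * norm x - (K - \<beta>) * (t * r)"
  have lba: "ereal c \<le> \<phi> a" using lb[of a] r by simp
  have near: "ereal ((v + t * c) / (1 + t)) \<le> \<phi> ?z" if y: "\<phi> y = ereal v" "dist x y \<le> t * r" for y v
  proof -
    let ?u = "t / (1 + t)"
    have 1: "1 - ?u = 1 / (1 + t)" using t by (simp add: field_simps)
    have "(1 - ?u) *\<^sub>R y + ?u *\<^sub>R a - ?z = (1 / (1 + t)) *\<^sub>R (y - x) + (?u + 1 / (1 + t) - 1) *\<^sub>R a"
      unfolding 1 by (simp add: algebra_simps inverse_eq_divide)
    also have "?u + 1 / (1 + t) - 1 = 0" using t by (simp add: field_simps)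
    finally have "dist ((1 - ?u) *\<^sub>R y + ?u *\<^sub>R a) ?z = dist x y / (1 + t)"
      using t by (simp add: dist_norm norm_minus_commute)
    also have "\<dots> \<le> ?u * r" using y(2) t by (simp add: divide_right_mono)
    finally have "ereal ((1 - ?u) * v + ?u * c) \<le> \<phi> ?z"
      using superlevel_at_cone_points[OF conc lb, where v=v and y=y and t="?u" and x="?z"] y(1) t by simp
    also have "(1 - ?u) * v + ?u * c = (v + t * c) / (1 + t)" unfolding 1 by (simp add: add_divide_distrib)
    finally show ?thesis .
  qed
  have far: "v - K * dist x y \<le> ?far" if y: "\<phi> y = ereal v" "\<not> dist x y \<le> t * r" for y v
    using envelope_term_le[OF \<beta> ub lba y(1), of x] mult_left_mono[of "t * r" "dist x y" "K - \<beta>"] y(2) \<beta> by simp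
  have exp_far: "ennreal (exp ?far) = ennreal (exp (- (K - \<beta>) * (t * r))) * ennreal (exp (\<alpha> - \<beta> * norm x))"
    by (simp add: ennreal_mult[symmetric] exp_add[symmetric] algebra_simps)
  show ?thesis
  proof (cases "\<phi> ?z")
    case (real w)
    let ?near = "(1 + t) * w - t * c"
    have "?f \<le> max ?near ?far"
    proof (rule envelope_le[OF \<beta> ub lba])
      fix y v assume y: "\<phi> y = ereal v"
      show "v - K * dist x y \<le> max ?near ?far"
      proof (cases "dist x y \<le> t * r")
        case True
        from near[OF y True] real have "(v + t * c) / (1 + t) \<le> w" by simp
        hence "v \<le> ?near" using t by (simp add: field_simps)
        moreover have "K * dist x y \<ge> 0" using \<beta> by simp
        ultimately show ?thesis by linarith
      next
        case False from far[OF y False] show ?thesis by simp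
      qed
    qed
    hence "exp ?f \<le> exp ?near + exp ?far"
      by (smt (verit) exp_gt_zero exp_le_cancel_iff)
    hence "ennreal (exp ?f) \<le> ennreal (exp ?near) + ennreal (exp ?far)"
      by (subst ennreal_plus[symmetric]) (auto intro!: ennreal_leI simp del: ennreal_plus)
    also have "ennreal (exp ?near) \<le> ennreal (exp (t * (\<alpha> - c))) * ennreal (exp w)"
    proof -
      have "w \<le> \<alpha> - \<beta> * norm ?z" using ub[of ?z] real by simp
      also have "\<dots> \<le> \<alpha>" using \<beta> by simp
      finally have "t * w \<le> t * \<alpha>" using t by simp
      thus ?thesis by (auto simp: ennreal_mult[symmetric] exp_add[symmetric] algebra_simps intro!: ennreal_leI)
    qed
    finally show ?thesis using real exp_far by (simp add: add_right_mono)
  next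
    case PInf thus ?thesis using ub[of ?z] by simp
  next
    case MInf
    have "?f \<le> ?far"
    proof (rule envelope_le[OF \<beta> ub lba])
      fix y v assume y: "\<phi> y = ereal v"
      show "v - K * dist x y \<le> ?far" using near[OF y] far[OF y] MInf by fastforce
    qed
    hence "ennreal (exp ?f) \<le> ennreal (exp ?far)" by (intro ennreal_leI) simp
    thus ?thesis using exp_far by (simp add: add_increasing)
  qed
qed

text \<open>The class in which the regularized near-maximizers live: integrals of its members against weakly
  convergent distributions can be compared uniformly.\<close>

definition tempered :: "real \<Rightarrow> real \<Rightarrow> real \<Rightarrow> 'a::euclidean_space \<Rightarrow> real \<Rightarrow> ('a \<Rightarrow> real) \<Rightarrow> bool" where
  "tempered K \<alpha> \<beta> a c f \<longleftrightarrow>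
     K-lipschitz_on UNIV f \<and> (\<lambda>x. ereal (f x)) \<in> Phi \<and> (\<forall>x. f x \<le> \<alpha> - \<beta> * norm x) \<and> c \<le> f a"

text \<open>Integrating the pointwise bound: the dilated term contributes \<open>\<integral> e\<^sup>\<phi>\<close> times a factor \<open>h(t)\<close> that
  tends to \<open>1\<close> as \<open>t\<close> decreases to \<open>0\<close>; then, for \<open>t\<close> fixed, the far term vanishes as \<open>K\<close> grows.\<close>

lemma Lipschitz_regularization:
  fixes a :: "'a::euclidean_space"
  assumes r: "r > 0" and \<beta>: "\<beta> > 0" and \<epsilon>: "\<epsilon> > 0"
  obtains K where "\<And>\<phi>. \<phi> \<in> Phi \<Longrightarrow> controlled \<alpha> \<beta> a r c I0 \<phi> \<Longrightarrow>
      \<exists>f. tempered K \<alpha> \<beta> a c f \<and> (\<forall>x. \<phi> x \<le> ereal (f x)) \<and>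
          (\<integral>\<^sup>+x. ennreal (exp (f x)) \<partial>lborel) \<le> (\<integral>\<^sup>+x. ext_exp (\<phi> x) \<partial>lborel) + ennreal \<epsilon>"
proof -
  let ?d = "DIM('a)"
  define J where "J = max 0 I0"
  define h where "h t = exp (t * (\<alpha> - c)) * (1 + t) ^ ?d" for t :: real
  have "(h \<longlongrightarrow> exp (0 * (\<alpha> - c)) * (1 + 0) ^ ?d) (at_right 0)"
    unfolding h_def by (intro tendsto_intros)
  hence "(h \<longlongrightarrow> 1) (at_right 0)" by simp
  from order_tendstoD(2)[OF this, of "1 + \<epsilon> / (2 * (J + 1))"]
  have "\<forall>\<^sub>F t in at_right 0. h t < 1 + \<epsilon> / (2 * (J + 1)) \<and> t > 0"
    using \<epsilon> by (auto simp: J_def add_pos_nonneg eventually_at_filter elim!: eventually_mono)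
  then obtain t where t: "t > 0" "h t < 1 + \<epsilon> / (2 * (J + 1))"
    by (metis (mono_tags, lifting) eventually_happens trivial_limit_at_right_real)
  obtain C where C: "C \<ge> 0" "(\<integral>\<^sup>+x. ennreal (exp (\<alpha> - \<beta> * norm (x::'a))) \<partial>lborel) = ennreal C"
    using exp_minus_norm_integral_finite[OF \<beta>, of \<alpha>, where 'a='a] by (metis ennreal_cases infinity_ennreal_def less_irrefl)
  \<comment> \<open>\<open>K\<close> makes the far term \<open>exp (- X) * C\<close>, which is at most \<open>C / X\<close>.\<close>
  define X where "X = 2 * (C + 1) / \<epsilon>"
  have X: "X > 0" using C \<epsilon> by (simp add: X_def)
  define K where "K = \<beta> + X / (t * r)"
  have K: "\<beta> \<le> K" "(K - \<beta>) * (t * r) = X" using X t r by (auto simp: K_def)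
  have mX: "- (K - \<beta>) * (t * r) = - X" using K(2) by (simp only: mult_minus_left)
  have half: "1 / (2 * D / \<epsilon>) * D = \<epsilon> / 2" if "D > 0" for D :: real using that \<epsilon> by (simp add: field_simps)
  have "X \<le> exp X" using exp_ge_add_one_self[of X] by linarith
  hence "exp (-X) \<le> 1 / X" using X by (simp add: exp_minus field_simps)
  hence "exp (-X) * C \<le> 1 / X * (C + 1)" using C X by (intro mult_mono) auto
  also have "\<dots> = \<epsilon> / 2" unfolding X_def by (rule half) (use C in simp)
  finally have eC: "exp (-X) * C \<le> \<epsilon> / 2" .
  show ?thesis
  proof (rule that[of K], intro exI conjI allI)
    fix \<phi> :: "'a \<Rightarrow> ereal"
    assume \<phi>: "\<phi> \<in> Phi" and ctl: "controlled \<alpha> \<beta> a r c I0 \<phi>"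
    have ub: "\<phi> x \<le> ereal (\<alpha> - \<beta> * norm x)" and lb: "dist a x \<le> r \<Longrightarrow> ereal c \<le> \<phi> x"
      and I0: "(\<integral>\<^sup>+x. ext_exp (\<phi> x) \<partial>lborel) \<le> ennreal I0" for x
      using ctl by (auto simp: controlled_def)
    let ?f = "lipschitz_envelope K \<phi>"
    have b0: "0 \<le> \<beta>" using \<beta> by simp
    have lba: "ereal c \<le> \<phi> a" using lb[of a] r by simp
    note env = b0 K(1) ub lba
    have ub': "?f x \<le> \<alpha> - \<beta> * norm x" for x by (rule envelope_upper[OF env])
    have "(\<lambda>x. ereal (?f x)) \<in> Phi"
      by (rule Lipschitz_concave_in_Phi[OF envelope_lipschitz[OF env] ub' \<beta>], rule envelope_concave[OF env PhiD(2)[OF \<phi>]])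
    thus "tempered K \<alpha> \<beta> a c ?f"
      using ub' envelope_lipschitz[OF env] envelope_lower[OF env] by (simp add: tempered_def)
    show "\<phi> x \<le> ereal (?f x)" for x by (rule envelope_majorizes[OF env])
    have [measurable]: "\<phi> \<in> borel_measurable borel" by (rule Phi_measurable[OF \<phi>])
    note ext_exp_measurable [measurable]
    obtain I where I: "I \<ge> 0" "(\<integral>\<^sup>+x. ext_exp (\<phi> x) \<partial>lborel) = ennreal I"
      using I0 by (metis ennreal_cases ennreal_neq_top neq_top_trans)
    have IJ: "I \<le> J" using I0 I by (auto simp: J_def ennreal_le_iff2)
    have "(\<integral>\<^sup>+x. ennreal (exp (?f x)) \<partial>lborel) \<le>
       (\<integral>\<^sup>+x. ennreal (exp (t * (\<alpha> - c))) * ext_exp (\<phi> (a + (x - a) /\<^sub>R (1 + t))) +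
         ennreal (exp (- (K - \<beta>) * (t * r))) * ennreal (exp (\<alpha> - \<beta> * norm x)) \<partial>lborel)"
      by (intro nn_integral_mono envelope_exp_bound[OF b0 K(1) PhiD(2)[OF \<phi>] ub lb r t(1)])
    also have "\<dots> = ennreal (exp (t * (\<alpha> - c))) * (ennreal ((1 + t) ^ ?d) * ennreal I) +
         ennreal (exp (- (K - \<beta>) * (t * r))) * ennreal C"
      using t nn_integral_dilation[of "\<lambda>x. ext_exp (\<phi> x)" "1 + t" a] C(2) I(2)
      by (simp add: nn_integral_add nn_integral_cmult)
    also have "\<dots> = ennreal (h t * I + exp (-X) * C)"
      using t(1) C(1) I(1) mX by (simp only: mX) (simp add: h_def ennreal_mult[symmetric] ennreal_plus[symmetric] mult_ac del: ennreal_plus)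
    also have "\<dots> \<le> ennreal (I + \<epsilon>)"
    proof (rule ennreal_leI)
      have "(h t - 1) * I \<le> \<epsilon> / (2 * (J + 1)) * (J + 1)" using t IJ I(1) \<epsilon> by (intro mult_mono) (auto simp: J_def)
      also have "\<dots> = \<epsilon> / 2"
      proof -
        have "\<epsilon> / (2 * D) * D = \<epsilon> / 2" if "D > 0" for D :: real using that by simp
        moreover have "J + 1 > 0" by (simp add: J_def add_nonneg_pos)
        ultimately show ?thesis by blast
      qed
      finally show "h t * I + exp (-X) * C \<le> I + \<epsilon>" using eC by (simp add: algebra_simps)
    qed
    finally show "(\<integral>\<^sup>+x. ennreal (exp (?f x)) \<partial>lborel) \<le> (\<integral>\<^sup>+x. ext_exp (\<phi> x) \<partial>lborel) + ennreal \<epsilon>"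
      using I \<epsilon> by simp
  qed
qed

section \<open>First moments and comparison of near-maximizers\<close>

lemma first_moment_finiteD:
  fixes Q :: "'a::euclidean_space measure"
  assumes Q: "Q \<in> distributions" and m: "first_moment Q < \<infinity>"
  shows "integrable Q norm" "first_moment Q = ennreal (integral\<^sup>L Q norm)"
proof -
  have "norm \<in> borel_measurable Q" by (rule continuous_measurable_distribution[OF Q]) (intro continuous_intros)
  thus i: "integrable Q norm" using m by (intro integrableI_bounded) (auto simp: first_moment_def)
  show "first_moment Q = ennreal (integral\<^sup>L Q norm)"
    unfolding first_moment_def by (rule nn_integral_eq_integral[OF i]) simp
qed

lemma Lipschitz_norm_bound:
  fixes f :: "'a::real_normed_vector \<Rightarrow> real"
  assumes "K-lipschitz_on UNIV f"
  shows "\<bar>f x - f a\<bar> \<le> K * (norm a + norm x)"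
proof -
  have K: "K \<ge> 0" using assms by (auto simp: lipschitz_on_def)
  have "\<bar>f x - f a\<bar> \<le> K * dist x a" using lipschitz_onD[OF assms, of x a] by (simp add: dist_real_def)
  also have "\<dots> \<le> K * (norm a + norm x)"
    using K norm_triangle_ineq4[of x a] by (intro mult_left_mono) (auto simp: dist_norm)
  finally show ?thesis .
qed

lemma Lipschitz_integrable:
  fixes f :: "'a::euclidean_space \<Rightarrow> real"
  assumes Q: "Q \<in> distributions" "first_moment Q < \<infinity>" and f: "K-lipschitz_on UNIV f"
  shows "integrable Q f"
proof -
  interpret prob_space Q using distributionsD[OF Q(1)] by simp
  have K: "K \<ge> 0" using f by (auto simp: lipschitz_on_def)
  show ?thesis
  proof (rule Bochner_Integration.integrable_bound)
    show "integrable Q (\<lambda>x. \<bar>f 0\<bar> + K * norm x)" using first_moment_finiteD(1)[OF Q] by simp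
    show "f \<in> borel_measurable Q"
      by (rule continuous_measurable_distribution[OF Q(1) lipschitz_on_continuous_on[OF f]])
    have "\<bar>f x\<bar> \<le> \<bar>f 0\<bar> + K * norm x" for x using Lipschitz_norm_bound[OF f, of x 0] by simp
    moreover have "\<bar>f 0\<bar> + K * norm x \<ge> 0" for x :: 'a using K by simp
    ultimately show "AE x in Q. norm (f x) \<le> norm (\<bar>f 0\<bar> + K * norm x)" by simp
  qed
qed

lemma L_fun_real:
  assumes "integrable Q f" "(\<integral>\<^sup>+x. ennreal (exp (f x)) \<partial>lborel) = ennreal J" "J \<ge> 0"
  shows "L_fun (\<lambda>x. ereal (f x)) Q = ereal (integral\<^sup>L Q f - J + 1)"
  unfolding L_fun_def ext_integral_real[OF assms(1)]
  using assms(2,3) by (simp add: enn2ereal_ennreal one_ereal_def)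

text \<open>Linear decay turns a lower bound on \<open>\<integral> \<phi> dQ\<close> into an upper bound on the first moment; the
  penalty term only helps.\<close>

lemma first_moment_bound_of_L_fun:
  fixes \<phi> :: "'a::euclidean_space \<Rightarrow> ereal"
  assumes Q: "Q \<in> distributions" and \<beta>: "\<beta> > 0"
    and ub: "\<And>x. \<phi> x \<le> ereal (\<alpha> - \<beta> * norm x)" and l: "ereal l \<le> L_fun \<phi> Q"
  shows "first_moment Q \<le> ennreal ((\<alpha> + 1 - l) / \<beta>)"
proof -
  interpret prob_space Q using distributionsD[OF Q] by simp
  have nm: "norm \<in> borel_measurable Q" by (rule continuous_measurable_distribution[OF Q]) (intro continuous_intros)
  have "\<phi> x \<le> ereal \<alpha>" for x by (rule order_trans[OF ub]) (use \<beta> in simp)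
  from L_fun_finite[OF Q this l] obtain I E where IE: "I \<ge> 0" "ext_integral Q \<phi> = ereal E" "L_fun \<phi> Q = ereal (E - I + 1)"
    by metis
  have le: "ereal E \<le> ext_integral Q (\<lambda>x. ereal (\<alpha> - \<beta> * norm x))"
    unfolding IE(2)[symmetric] by (rule ext_integral_mono) (rule ub)
  have fin: "first_moment Q < \<infinity>"
  proof (rule ccontr)
    assume "\<not> first_moment Q < \<infinity>"
    hence "\<infinity> = ennreal \<beta> * first_moment Q" using \<beta> by (simp add: less_top[symmetric] ennreal_mult_top)
    also have "\<dots> = (\<integral>\<^sup>+x. ennreal (\<beta> * norm x) \<partial>Q)"
      using \<beta> nm by (simp add: first_moment_def nn_integral_cmult[symmetric] ennreal_mult)
    also have "\<dots> \<le> (\<integral>\<^sup>+x. ennreal (\<beta> * norm x - \<alpha>) + ennreal \<bar>\<alpha>\<bar> \<partial>Q)"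
    proof (rule nn_integral_mono)
      fix x :: 'a
      have "ennreal (\<beta> * norm x) \<le> ennreal (max 0 (\<beta> * norm x - \<alpha>) + \<bar>\<alpha>\<bar>)" by (intro ennreal_leI) linarith
      also have "\<dots> = ennreal (max 0 (\<beta> * norm x - \<alpha>)) + ennreal \<bar>\<alpha>\<bar>" by (rule ennreal_plus) auto
      finally show "ennreal (\<beta> * norm x) \<le> ennreal (\<beta> * norm x - \<alpha>) + ennreal \<bar>\<alpha>\<bar>" by simp
    qed
    also have "\<dots> = (\<integral>\<^sup>+x. ennreal (\<beta> * norm x - \<alpha>) \<partial>Q) + ennreal \<bar>\<alpha>\<bar>"
      using nm by (simp add: nn_integral_add emeasure_space_1)
    finally have neg: "(\<integral>\<^sup>+x. ennreal (\<beta> * norm x - \<alpha>) \<partial>Q) = \<infinity>"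
      by (metis ennreal_add_eq_top ennreal_neq_top infinity_ennreal_def top.extremum_unique)
    have "(\<integral>\<^sup>+x. ennreal (\<alpha> - \<beta> * norm x) \<partial>Q) \<le> (\<integral>\<^sup>+x. ennreal \<bar>\<alpha>\<bar> \<partial>Q)"
      using \<beta> by (intro nn_integral_mono ennreal_leI) (smt (verit) mult_nonneg_nonneg norm_ge_zero)
    hence "(\<integral>\<^sup>+x. ennreal (\<alpha> - \<beta> * norm x) \<partial>Q) < \<infinity>" by (simp add: emeasure_space_1 le_less_trans)
    then obtain p where "p \<ge> 0" "(\<integral>\<^sup>+x. ennreal (\<alpha> - \<beta> * norm x) \<partial>Q) = ennreal p"
      by (metis ennreal_cases infinity_ennreal_def less_irrefl)
    hence "ext_integral Q (\<lambda>x. ereal (\<alpha> - \<beta> * norm x)) = -\<infinity>"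
      unfolding ext_integral_def using neg by (simp add: e2ennreal_ereal enn2ereal_ennreal)
    thus False using le by simp
  qed
  note i = first_moment_finiteD[OF Q fin]
  have "ereal E \<le> ereal (\<integral>x. \<alpha> - \<beta> * norm x \<partial>Q)"
    using le by (subst (asm) ext_integral_real) (use i in auto)
  hence "E \<le> \<alpha> - \<beta> * integral\<^sup>L Q norm" using i(1) by (simp add: prob_space)
  hence "\<beta> * integral\<^sup>L Q norm \<le> \<alpha> + 1 - l" using IE l by simp
  hence "integral\<^sup>L Q norm \<le> (\<alpha> + 1 - l) / \<beta>" using \<beta> by (simp add: field_simps)
  thus ?thesis unfolding i(2) by (rule ennreal_leI)
qed

text \<open>Fatou's lemma for weak convergence: truncations of \<open>h\<close> are bounded and continuous, and increase to
  \<open>h\<close>.\<close>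

lemma weakly_converges_liminf_nn_integral:
  fixes h :: "'a::euclidean_space \<Rightarrow> real"
  assumes Qs: "\<And>n. Qs n \<in> distributions" and Q: "Q \<in> distributions" and w: "weakly_converges Qs Q"
    and h: "continuous_on UNIV h" "\<And>x. h x \<ge> 0"
  shows "(\<integral>\<^sup>+x. ennreal (h x) \<partial>Q) \<le> liminf (\<lambda>n. \<integral>\<^sup>+x. ennreal (h x) \<partial>Qs n)"
proof -
  define g where "g N x = min (h x) (real N)" for N :: nat and x
  have gc: "continuous_on UNIV (g N)" for N unfolding g_def by (intro continuous_intros h)
  have gb: "\<bar>g N x\<bar> \<le> real N" "g N x \<ge> 0" for N x using h(2)[of x] by (auto simp: g_def)
  have gi: "(\<integral>\<^sup>+x. ennreal (g N x) \<partial>R) = ennreal (integral\<^sup>L R (g N))" if "R \<in> distributions" for R N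
    by (rule nn_integral_eq_integral[OF bounded_continuous_integrable[OF that gc gb(1)]]) (simp add: gb)
  have le: "(\<integral>\<^sup>+x. ennreal (g N x) \<partial>Q) \<le> liminf (\<lambda>n. \<integral>\<^sup>+x. ennreal (h x) \<partial>Qs n)" for N
  proof -
    have "(\<lambda>n. \<integral>\<^sup>+x. ennreal (g N x) \<partial>Qs n) \<longlonglongrightarrow> (\<integral>\<^sup>+x. ennreal (g N x) \<partial>Q)"
      unfolding gi[OF Qs] gi[OF Q] by (intro tendsto_ennrealI weakly_convergesD[OF w gc gb(1)])
    hence "(\<integral>\<^sup>+x. ennreal (g N x) \<partial>Q) = liminf (\<lambda>n. \<integral>\<^sup>+x. ennreal (g N x) \<partial>Qs n)"
      by (rule lim_imp_Liminf[OF sequentially_bot, symmetric])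
    also have "\<dots> \<le> liminf (\<lambda>n. \<integral>\<^sup>+x. ennreal (h x) \<partial>Qs n)"
      by (intro Liminf_mono always_eventually allI nn_integral_mono ennreal_leI) (simp add: g_def)
    finally show ?thesis .
  qed
  have sup: "ennreal (h x) = (SUP N. ennreal (g N x))" for x
  proof (rule antisym)
    obtain N :: nat where "h x \<le> real N" using real_arch_simple by blast
    hence "ennreal (h x) = ennreal (g N x)" by (simp add: g_def)
    also have "\<dots> \<le> (SUP N. ennreal (g N x))" by (rule SUP_upper) simp
    finally show "ennreal (h x) \<le> (SUP N. ennreal (g N x))" .
  qed (auto intro!: SUP_least ennreal_leI simp: g_def)
  have "(\<integral>\<^sup>+x. ennreal (h x) \<partial>Q) = (SUP N. \<integral>\<^sup>+x. ennreal (g N x) \<partial>Q)"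
    unfolding sup
  proof (rule nn_integral_monotone_convergence_SUP)
    show "incseq (\<lambda>N x. ennreal (g N x))" by (auto simp: incseq_def le_fun_def g_def intro!: ennreal_leI)
    show "(\<lambda>x. ennreal (g N x)) \<in> borel_measurable Q" for N
      by (rule measurable_compose[OF continuous_measurable_distribution[OF Q gc] measurable_ennreal])
  qed
  also have "\<dots> \<le> liminf (\<lambda>n. \<integral>\<^sup>+x. ennreal (h x) \<partial>Qs n)" by (rule SUP_least) (rule le)
  finally show ?thesis .
qed

lemma first_moment_liminf:
  fixes Q :: "'a::euclidean_space measure"
  assumes "\<And>n. Qs n \<in> distributions" "Q \<in> distributions" "weakly_converges Qs Q"
  shows "first_moment Q \<le> liminf (\<lambda>n. first_moment (Qs n))"
  unfolding first_moment_def
  by (rule weakly_converges_liminf_nn_integral[OF assms]) (auto intro!: continuous_intros)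

lemma tail_expectation_small:
  fixes Q :: "'a::euclidean_space measure"
  assumes Q: "Q \<in> distributions" "first_moment Q < \<infinity>" and \<epsilon>: "\<epsilon> > 0"
  obtains M where "M \<ge> 0" "(\<integral>x. max 0 (A + K * norm x - M) \<partial>Q) \<le> \<epsilon>"
proof -
  interpret prob_space Q using distributionsD[OF Q(1)] by simp
  have "(\<lambda>n::nat. \<integral>x. max 0 (A + K * norm x - real n) \<partial>Q) \<longlonglongrightarrow> (\<integral>x. 0 \<partial>Q)"
  proof (rule integral_dominated_convergence[where w="\<lambda>x. \<bar>A\<bar> + \<bar>K\<bar> * norm x"])
    show "integrable Q (\<lambda>x. \<bar>A\<bar> + \<bar>K\<bar> * norm x)"
      using first_moment_finiteD(1)[OF Q] by simp
    show "(\<lambda>x. max 0 (A + K * norm x - real n)) \<in> borel_measurable Q" for n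
      by (rule continuous_measurable_distribution[OF Q(1)]) (intro continuous_intros)
    show "AE x in Q. (\<lambda>n. max 0 (A + K * norm x - real n)) \<longlonglongrightarrow> 0"
    proof (rule AE_I2)
      fix x
      obtain N :: nat where "A + K * norm x \<le> real N" using real_arch_simple by blast
      hence "\<forall>n\<ge>N. max 0 (A + K * norm x - real n) = 0" by auto
      thus "(\<lambda>n. max 0 (A + K * norm x - real n)) \<longlonglongrightarrow> 0"
        by (intro tendsto_eventually) (auto simp: eventually_sequentially)
    qed
    show "AE x in Q. norm (max 0 (A + K * norm x - real n)) \<le> \<bar>A\<bar> + \<bar>K\<bar> * norm x" for n
    proof (rule AE_I2)
      fix x :: 'a
      have "K * norm x \<le> \<bar>K\<bar> * norm x" by (intro mult_right_mono) auto
      moreover have "0 \<le> \<bar>K\<bar> * norm x" by simp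
      ultimately show "norm (max 0 (A + K * norm x - real n)) \<le> \<bar>A\<bar> + \<bar>K\<bar> * norm x" by simp
    qed
  qed simp
  hence "(\<lambda>n::nat. \<integral>x. max 0 (A + K * norm x - real n) \<partial>Q) \<longlonglongrightarrow> 0" by simp
  from order_tendstoD(2)[OF this \<epsilon>] obtain n :: nat where "(\<integral>x. max 0 (A + K * norm x - real n) \<partial>Q) < \<epsilon>"
    by (auto simp: eventually_sequentially)
  thus ?thesis using that[of "real n"] by simp
qed

lemma L_fun_le_L_sup: "\<phi> \<in> Phi \<Longrightarrow> L_fun \<phi> Q \<le> L_sup Q"
  unfolding L_sup_def by (rule SUP_upper)

text \<open>Passing to the Lipschitz majorant increases \<open>\<integral> \<phi> dQ\<close> and costs at most \<open>\<epsilon>\<close> in the penalty, so it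
  loses at most \<open>\<epsilon>\<close> in \<open>L\<close>. The value \<open>J\<close> of the penalty is kept apart from \<open>Q\<close>, because the same \<open>f\<close> is
  afterwards evaluated against another distribution.\<close>

lemma near_maximizer_majorant:
  fixes a :: "'a::euclidean_space"
  assumes r: "r > 0" and \<beta>: "\<beta> > 0" and \<epsilon>: "\<epsilon> > 0"
  obtains K where "\<And>Q \<phi> l. Q \<in> distributions \<Longrightarrow> \<phi> \<in> Phi \<Longrightarrow> controlled \<alpha> \<beta> a r c I0 \<phi> \<Longrightarrow> ereal l \<le> L_fun \<phi> Q \<Longrightarrow>
      first_moment Q < \<infinity> \<and> (\<exists>f J. tempered K \<alpha> \<beta> a c f \<and> 0 \<le> J \<and>
        (\<integral>\<^sup>+x. ennreal (exp (f x)) \<partial>lborel) = ennreal J \<and> l \<le> integral\<^sup>L Q f - J + 1 + \<epsilon>)"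
proof -
  obtain K where reg: "\<And>\<phi>. \<phi> \<in> Phi \<Longrightarrow> controlled \<alpha> \<beta> a r c I0 \<phi> \<Longrightarrow>
      \<exists>f. tempered K \<alpha> \<beta> a c f \<and> (\<forall>x. \<phi> x \<le> ereal (f x)) \<and>
          (\<integral>\<^sup>+x. ennreal (exp (f x)) \<partial>lborel) \<le> (\<integral>\<^sup>+x. ext_exp (\<phi> x) \<partial>lborel) + ennreal \<epsilon>"
    by (rule Lipschitz_regularization[OF r \<beta> \<epsilon>, where \<alpha>=\<alpha> and a=a and c=c and ?I0.0=I0], rule that)
  show ?thesis
  proof (rule that[of K])
    fix Q and \<phi> :: "'a \<Rightarrow> ereal" and l
    assume Q: "Q \<in> distributions" and \<phi>: "\<phi> \<in> Phi" and ctl: "controlled \<alpha> \<beta> a r c I0 \<phi>" and l: "ereal l \<le> L_fun \<phi> Q"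
    have ub: "\<phi> x \<le> ereal (\<alpha> - \<beta> * norm x)" for x using ctl by (simp add: controlled_def)
    have "first_moment Q \<le> ennreal ((\<alpha> + 1 - l) / \<beta>)"
      by (rule first_moment_bound_of_L_fun[OF Q \<beta> ub l])
    hence m: "first_moment Q < \<infinity>" by (simp add: le_less_trans)
    have "\<phi> x \<le> ereal \<alpha>" for x by (rule order_trans[OF ub]) (use \<beta> in simp)
    from L_fun_finite[OF Q this l] obtain I E where IE: "I \<ge> 0" "(\<integral>\<^sup>+x. ext_exp (\<phi> x) \<partial>lborel) = ennreal I"
      "ext_integral Q \<phi> = ereal E" "L_fun \<phi> Q = ereal (E - I + 1)" by metis
    obtain f where f: "tempered K \<alpha> \<beta> a c f" "\<And>x. \<phi> x \<le> ereal (f x)"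
      and J: "(\<integral>\<^sup>+x. ennreal (exp (f x)) \<partial>lborel) \<le> (\<integral>\<^sup>+x. ext_exp (\<phi> x) \<partial>lborel) + ennreal \<epsilon>"
      using reg[OF \<phi> ctl] by blast
    have J': "(\<integral>\<^sup>+x. ennreal (exp (f x)) \<partial>lborel) \<le> ennreal (I + \<epsilon>)" using J IE \<epsilon> by simp
    then obtain J where J: "(\<integral>\<^sup>+x. ennreal (exp (f x)) \<partial>lborel) = ennreal J" "J \<ge> 0"
      by (metis ennreal_cases ennreal_neq_top neq_top_trans)
    have "J \<le> I + \<epsilon>" using J' J IE(1) \<epsilon> by (simp add: ennreal_le_iff del: ennreal_plus)
    moreover have "integrable Q f"
      using f(1) by (intro Lipschitz_integrable[OF Q m]) (auto simp: tempered_def)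
    hence "E \<le> integral\<^sup>L Q f"
      using ext_integral_mono[of \<phi> "\<lambda>x. ereal (f x)" Q] f(2) IE(3) by (simp add: ext_integral_real)
    moreover have "l \<le> E - I + 1" using l IE(4) by simp
    ultimately have "l \<le> integral\<^sup>L Q f - J + 1 + \<epsilon>" by linarith
    thus "first_moment Q < \<infinity> \<and> (\<exists>f J. tempered K \<alpha> \<beta> a c f \<and> 0 \<le> J \<and>
        (\<integral>\<^sup>+x. ennreal (exp (f x)) \<partial>lborel) = ennreal J \<and> l \<le> integral\<^sup>L Q f - J + 1 + \<epsilon>)"
      using m f(1) J by blast
  qed
qed

text \<open>The central estimate. A competitor for \<open>Q\<^sub>n\<close> with value at least \<open>s\<close> gives one for \<open>Q\<close> with value
  at least \<open>s + \<beta> (m\<^sub>n - m) - \<epsilon>\<close>: the mass that escapes to infinity shows up as an excess \<open>m\<^sub>n - m\<close> of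
  first moments, and on it \<open>\<phi>\<close> is at most \<open>- \<beta> \<parallel>x\<parallel>\<close> up to a constant.\<close>

lemma near_maximizer_transfer:
  fixes Qs :: "nat \<Rightarrow> 'a::euclidean_space measure"
  assumes Qs: "\<And>n. Qs n \<in> distributions" and Q: "Q \<in> Qo" and w: "weakly_converges Qs Q"
    and m: "first_moment Q < \<infinity>"
  obtains \<beta> where "\<beta> > 0" "\<And>\<epsilon>. \<epsilon> > 0 \<Longrightarrow> \<forall>\<^sub>F n in sequentially. \<forall>\<phi>\<in>Phi. \<forall>s\<ge>l. ereal s \<le> L_fun \<phi> (Qs n) \<longrightarrow>
     first_moment (Qs n) < \<infinity> \<and> ereal (s + \<beta> * (integral\<^sup>L (Qs n) norm - integral\<^sup>L Q norm) - \<epsilon>) \<le> L_sup Q"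
proof -
  have Qd: "Q \<in> distributions" using Q by (simp add: Qo_def)
  interpret prob_space Q using distributionsD[OF Qd] by simp
  obtain a r \<delta> where r: "r > 0" "\<delta> > 0" "\<delta> \<le> 1" and sp: "\<forall>\<^sub>F n in sequentially. spreads a r \<delta> (Qs n)"
    by (rule spreads_eventually[OF Qs Q w])
  obtain \<alpha> \<beta> c I0 where \<beta>: "\<beta> > 0" and ctl: "\<And>Q \<phi>. Q \<in> distributions \<Longrightarrow> spreads a r \<delta> Q \<Longrightarrow> \<phi> \<in> Phi \<Longrightarrow> ereal l \<le> L_fun \<phi> Q \<Longrightarrow>
     controlled \<alpha> \<beta> a r c I0 \<phi>"
    by (rule near_maximizer_control[OF r, where l=l and a=a], rule that)
  show ?thesis
  proof (rule that[OF \<beta>])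
    fix \<epsilon> :: real assume "\<epsilon> > 0"
    hence \<epsilon>: "\<epsilon> / 4 > 0" by simp
    obtain K where maj: "\<And>Q \<phi> l. Q \<in> distributions \<Longrightarrow> \<phi> \<in> Phi \<Longrightarrow> controlled \<alpha> \<beta> a r c I0 \<phi> \<Longrightarrow> ereal l \<le> L_fun \<phi> Q \<Longrightarrow>
      first_moment Q < \<infinity> \<and> (\<exists>f J. tempered K \<alpha> \<beta> a c f \<and> 0 \<le> J \<and>
        (\<integral>\<^sup>+x. ennreal (exp (f x)) \<partial>lborel) = ennreal J \<and> l \<le> integral\<^sup>L Q f - J + 1 + \<epsilon> / 4)"
      by (rule near_maximizer_majorant[OF r(1) \<beta> \<epsilon>, where \<alpha>=\<alpha> and a=a and c=c and ?I0.0=I0], rule that)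
    define A where "A = K * norm a - c"
    obtain M where M: "M \<ge> 0" "(\<integral>x. max 0 (A + K * norm x - M) \<partial>Q) \<le> \<epsilon> / 4"
      by (rule tail_expectation_small[OF Qd m \<epsilon>])
    have tail_int: "integrable Q (\<lambda>x. max 0 (A + K * norm x - M))"
      using first_moment_finiteD(1)[OF Qd m] by (intro Bochner_Integration.integrable_max) auto
    show "\<forall>\<^sub>F n in sequentially. \<forall>\<phi>\<in>Phi. \<forall>s\<ge>l. ereal s \<le> L_fun \<phi> (Qs n) \<longrightarrow>
     first_moment (Qs n) < \<infinity> \<and> ereal (s + \<beta> * (integral\<^sup>L (Qs n) norm - integral\<^sup>L Q norm) - \<epsilon>) \<le> L_sup Q"
      using sp weakly_converges_uniform_Lipschitz[OF Qs Qd w \<epsilon>, of "K + \<beta>" "\<bar>\<alpha>\<bar> + M"]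
    proof eventually_elim
      case (elim n)
      interpret Qn: prob_space "Qs n" using distributionsD[OF Qs] by simp
      show ?case
      proof (intro ballI allI impI)
        fix \<phi> :: "'a \<Rightarrow> ereal" and s assume \<phi>: "\<phi> \<in> Phi" and s: "s \<ge> l" "ereal s \<le> L_fun \<phi> (Qs n)"
        have "ereal l \<le> L_fun \<phi> (Qs n)" using s by (meson ereal_less_eq(3) order_trans)
        note c = ctl[OF Qs elim(1) \<phi> this]
        from maj[OF Qs \<phi> c s(2)] obtain f J where mn: "first_moment (Qs n) < \<infinity>" and tf: "tempered K \<alpha> \<beta> a c f"
          and J: "(\<integral>\<^sup>+x. ennreal (exp (f x)) \<partial>lborel) = ennreal J" "0 \<le> J"
          and sJ: "s \<le> integral\<^sup>L (Qs n) f - J + 1 + \<epsilon> / 4" by blast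
        have f: "K-lipschitz_on UNIV f" "(\<lambda>x. ereal (f x)) \<in> Phi" "\<And>x. f x \<le> \<alpha> - \<beta> * norm x" "c \<le> f a"
          using tf by (auto simp: tempered_def)
        have fi: "integrable R f" if "R \<in> distributions" "first_moment R < \<infinity>" for R
          by (rule Lipschitz_integrable[OF that f(1)])
        note ni = first_moment_finiteD(1)
        \<comment> \<open>Adding \<open>\<beta> * norm x\<close> keeps \<open>f\<close> bounded above by \<open>\<alpha>\<close>. Truncation at \<open>- M\<close> makes it bounded, increases
          its integral against \<open>Qs n\<close>, and changes the one against \<open>Q\<close> by at most \<open>\<epsilon> / 4\<close>.\<close>
        define g where "g x = f x + \<beta> * norm x" for x
        define h where "h x = max (g x) (- M)" for x
        have g_le: "g x \<le> \<alpha>" for x using f(3)[of x] by (simp add: g_def)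
        have g_ge: "- (A + K * norm x) \<le> g x" for x
        proof -
          have "0 \<le> \<beta> * norm x" using \<beta> by simp
          thus ?thesis using Lipschitz_norm_bound[OF f(1), of x a] f(4) by (simp add: g_def A_def algebra_simps)
        qed
        have K: "K \<ge> 0" using f(1) by (auto simp: lipschitz_on_def)
        have g_lip: "(K + \<beta>)-lipschitz_on UNIV g"
        proof (rule lipschitz_onI)
          fix x y :: 'a
          have "\<bar>\<beta> * norm x - \<beta> * norm y\<bar> = \<beta> * \<bar>norm x - norm y\<bar>"
            using \<beta> by (simp add: abs_mult right_diff_distrib[symmetric])
          also have "\<dots> \<le> \<beta> * dist x y"
            using \<beta> norm_triangle_ineq3[of x y] by (simp add: dist_norm)
          finally show "dist (g x) (g y) \<le> (K + \<beta>) * dist x y"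
            using lipschitz_onD[OF f(1), of x y] unfolding g_def dist_real_def distrib_right by simp
        qed (use K \<beta> in simp)
        have h_lip: "(K + \<beta>)-lipschitz_on UNIV h"
        proof (rule lipschitz_onI)
          fix x y
          have "dist (h x) (h y) \<le> dist (g x) (g y)" by (auto simp: h_def dist_real_def)
          also have "\<dots> \<le> (K + \<beta>) * dist x y" using lipschitz_onD[OF g_lip] by simp
          finally show "dist (h x) (h y) \<le> (K + \<beta>) * dist x y" .
        qed (use K \<beta> in simp)
        have "\<bar>h x\<bar> \<le> \<bar>\<alpha>\<bar> + M" for x using g_le[of x] M(1) by (auto simp: h_def)
        hence "\<bar>integral\<^sup>L (Qs n) h - integral\<^sup>L Q h\<bar> \<le> \<epsilon> / 4" using elim(2) h_lip by simp
        hence unif: "integral\<^sup>L (Qs n) h \<le> integral\<^sup>L Q h + \<epsilon> / 4" by linarith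
        have "integral\<^sup>L (Qs n) g \<le> integral\<^sup>L (Qs n) h"
          by (intro integral_mono Lipschitz_integrable[OF Qs mn g_lip] Lipschitz_integrable[OF Qs mn h_lip]) (simp add: h_def)
        moreover have "integral\<^sup>L Q h \<le> (\<integral>x. g x + max 0 (A + K * norm x - M) \<partial>Q)"
        proof (intro integral_mono Lipschitz_integrable[OF Qd m h_lip] Bochner_Integration.integrable_add
            Lipschitz_integrable[OF Qd m g_lip] tail_int)
          fix x show "h x \<le> g x + max 0 (A + K * norm x - M)" using g_ge[of x] by (auto simp: h_def)
        qed
        moreover have "\<dots> = integral\<^sup>L Q g + (\<integral>x. max 0 (A + K * norm x - M) \<partial>Q)"
          by (rule Bochner_Integration.integral_add[OF Lipschitz_integrable[OF Qd m g_lip] tail_int])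
        moreover have gR: "integral\<^sup>L R g = integral\<^sup>L R f + \<beta> * integral\<^sup>L R norm" if "R \<in> distributions" "first_moment R < \<infinity>" for R
          unfolding g_def using fi[OF that] ni[OF that] by simp
        ultimately have "integral\<^sup>L (Qs n) f + \<beta> * integral\<^sup>L (Qs n) norm \<le> integral\<^sup>L Q f + \<beta> * integral\<^sup>L Q norm + \<epsilon> / 2"
          using unif M(2) gR[OF Qs mn] gR[OF Qd m] by linarith
        hence "s + \<beta> * (integral\<^sup>L (Qs n) norm - integral\<^sup>L Q norm) - \<epsilon> \<le> integral\<^sup>L Q f - J + 1"
          using sJ \<epsilon> by (simp add: right_diff_distrib)
        hence "ereal (s + \<beta> * (integral\<^sup>L (Qs n) norm - integral\<^sup>L Q norm) - \<epsilon>) \<le> L_fun (\<lambda>x. ereal (f x)) Q"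
          by (simp add: L_fun_real[OF fi[OF Qd m] J])
        also have "\<dots> \<le> L_sup Q" by (rule L_fun_le_L_sup[OF f(2)])
        finally show "first_moment (Qs n) < \<infinity> \<and> ereal (s + \<beta> * (integral\<^sup>L (Qs n) norm - integral\<^sup>L Q norm) - \<epsilon>) \<le> L_sup Q"
          using mn by blast
      qed
    qed
  qed
qed

section \<open>Semicontinuity of the maximal log-likelihood functional\<close>

lemma L_sup_witness:
  assumes "y < L_sup Q"
  obtains \<phi> where "\<phi> \<in> Phi" "y < L_fun \<phi> Q"
  using assms unfolding L_sup_def less_SUP_iff by blast

lemma frequently_less_limsup:
  fixes f :: "nat \<Rightarrow> 'b::complete_linorder"
  assumes "x < limsup f" shows "\<exists>\<^sub>F n in sequentially. x < f n"
proof (rule ccontr)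
  assume "\<not> ?thesis"
  hence "\<forall>\<^sub>F n in sequentially. f n \<le> x" by (simp add: frequently_def not_less)
  from Limsup_bounded[OF this] assms show False by simp
qed

text \<open>Finiteness from above comes from the uniform peak bound, from below from the test function
  \<open>- \<parallel>x\<parallel>\<close>.\<close>

lemma L_sup_finite:
  fixes Q :: "'a::euclidean_space measure"
  assumes Q: "Q \<in> Qo" and m: "first_moment Q < \<infinity>"
  obtains v where "L_sup Q = ereal v"
proof -
  have Qd: "Q \<in> distributions" using Q by (simp add: Qo_def)
  obtain a r \<delta> where r: "r > 0" "\<delta> > 0" "\<delta> \<le> 1" and sp: "spreads a r \<delta> Q" by (rule spreads_Qo[OF Q])
  obtain \<alpha> \<beta> c I0 where \<beta>: "\<beta> > 0" and ctl: "\<And>Q \<phi>. Q \<in> distributions \<Longrightarrow> spreads a r \<delta> Q \<Longrightarrow> \<phi> \<in> Phi \<Longrightarrow> ereal 0 \<le> L_fun \<phi> Q \<Longrightarrow>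
     controlled \<alpha> \<beta> a r c I0 \<phi>"
    by (rule near_maximizer_control[OF r, where l=0 and a=a], rule that)
  define B where "B = max 0 (\<alpha> + 1)"
  have "L_sup Q \<le> ereal B" unfolding L_sup_def
  proof (rule SUP_least)
    fix \<phi> :: "'a \<Rightarrow> ereal" assume \<phi>: "\<phi> \<in> Phi"
    show "L_fun \<phi> Q \<le> ereal B"
    proof (cases "ereal 0 \<le> L_fun \<phi> Q")
      case True
      have "\<phi> x \<le> ereal \<alpha>" for x
        by (rule order_trans[of _ "ereal (\<alpha> - \<beta> * norm x)"]) (use ctl[OF Qd sp \<phi> True] \<beta> in \<open>auto simp: controlled_def\<close>)
      from L_fun_finite[OF Qd this True] obtain I E where IE: "I \<ge> 0" "L_fun \<phi> Q = ereal (E - I + 1)" "E \<le> \<alpha>" by metis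
      hence "E - I + 1 \<le> B" unfolding B_def by linarith
      thus ?thesis unfolding IE(2) by (simp only: ereal_less_eq)
    next
      case False
      hence "L_fun \<phi> Q \<le> ereal 0" by simp
      also have "\<dots> \<le> ereal B" by (simp add: B_def)
      finally show ?thesis .
    qed
  qed
  moreover have "L_sup Q \<noteq> -\<infinity>"
  proof -
    let ?f = "\<lambda>x::'a. - norm x"
    have lip: "1-lipschitz_on UNIV ?f"
      by (rule lipschitz_onI) (auto simp: dist_real_def dist_norm norm_triangle_ineq3 abs_minus_commute)
    have "(\<lambda>x. ereal (?f x)) \<in> Phi"
    proof (rule Lipschitz_concave_in_Phi[OF lip, of 0 1])
      fix s t :: real and x y :: 'a assume "0 \<le> s" "0 \<le> t"
      thus "s * - norm x + t * - norm y \<le> - norm (s *\<^sub>R x + t *\<^sub>R y)"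
        using norm_triangle_ineq[of "s *\<^sub>R x" "t *\<^sub>R y"] by simp
    qed auto
    moreover obtain J where J: "(\<integral>\<^sup>+x. ennreal (exp (?f x)) \<partial>lborel) = ennreal J" "J \<ge> 0"
      using exp_minus_norm_integral_finite[of 1 0, where 'a='a]
      by (simp) (metis ennreal_cases less_irrefl top.not_eq_extremum)
    ultimately have "ereal (integral\<^sup>L Q ?f - J + 1) \<le> L_sup Q"
      using L_fun_le_L_sup[of "\<lambda>x. ereal (?f x)" Q] L_fun_real[OF Lipschitz_integrable[OF Qd m lip] J] by simp
    thus ?thesis by auto
  qed
  ultimately show ?thesis using that by (cases "L_sup Q") auto
qed

text \<open>Fatou's lemma for weak convergence applies to the nonnegative function \<open>f + \<bar>f 0\<bar> + K \<parallel>x\<parallel>\<close>; the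
  part \<open>K \<parallel>x\<parallel>\<close> may then be subtracted because the first moments do not overshoot.\<close>

lemma Lipschitz_integral_lower:
  fixes Qs :: "nat \<Rightarrow> 'a::euclidean_space measure"
  assumes Qs: "\<And>n. Qs n \<in> distributions" and Q: "Q \<in> distributions" and w: "weakly_converges Qs Q"
    and m: "first_moment Q < \<infinity>" "limsup (\<lambda>n. first_moment (Qs n)) \<le> first_moment Q"
    and f: "K-lipschitz_on UNIV (f :: 'a \<Rightarrow> real)" and \<epsilon>: "\<epsilon> > 0"
  shows "\<forall>\<^sub>F n in sequentially. first_moment (Qs n) < \<infinity> \<and> integral\<^sup>L Q f - \<epsilon> \<le> integral\<^sup>L (Qs n) f"
proof -
  have K: "K \<ge> 0" using f by (auto simp: lipschitz_on_def)
  define A where "A = \<bar>f 0\<bar>"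
  define h where "h x = f x + A + K * norm x" for x
  have h0: "h x \<ge> 0" for x using Lipschitz_norm_bound[OF f, of x 0] unfolding h_def A_def by (simp add: abs_le_iff) linarith
  have hc: "continuous_on UNIV h" unfolding h_def by (intro continuous_intros lipschitz_on_continuous_on[OF f])
  have hR: "integral\<^sup>L R h = integral\<^sup>L R f + A + K * integral\<^sup>L R norm"
    "(\<integral>\<^sup>+x. ennreal (h x) \<partial>R) = ennreal (integral\<^sup>L R h)" "integral\<^sup>L R h \<ge> 0"
    if R: "R \<in> distributions" "first_moment R < \<infinity>" for R
  proof -
    interpret prob_space R using distributionsD[OF R(1)] by simp
    note i = Lipschitz_integrable[OF R f] first_moment_finiteD(1)[OF R]
    show "integral\<^sup>L R h = integral\<^sup>L R f + A + K * integral\<^sup>L R norm"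
      unfolding h_def using i by (simp add: prob_space)
    have "integrable R h" unfolding h_def using i by simp
    thus "(\<integral>\<^sup>+x. ennreal (h x) \<partial>R) = ennreal (integral\<^sup>L R h)" by (rule nn_integral_eq_integral) (simp add: h0)
    show "integral\<^sup>L R h \<ge> 0" by (rule Bochner_Integration.integral_nonneg) (rule h0)
  qed
  define \<eta> where "\<eta> = \<epsilon> / (2 * (K + 1))"
  have \<eta>: "\<eta> > 0" "K * \<eta> \<le> \<epsilon> / 2" unfolding \<eta>_def using K \<epsilon> by (auto simp: field_simps)
  note mQ = first_moment_finiteD(2)[OF Q m(1)]
  have mQ0: "integral\<^sup>L Q norm \<ge> 0" by (rule Bochner_Integration.integral_nonneg) simp
  have "limsup (\<lambda>n. first_moment (Qs n)) < ennreal (integral\<^sup>L Q norm + \<eta>)"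
    by (rule le_less_trans[OF m(2)]) (use mQ mQ0 \<eta> in \<open>simp add: ennreal_less_iff del: ennreal_plus\<close>)
  from Limsup_lessD[OF this]
  have 1: "\<forall>\<^sub>F n in sequentially. first_moment (Qs n) < ennreal (integral\<^sup>L Q norm + \<eta>)" .
  have 2: "\<forall>\<^sub>F n in sequentially. ennreal (integral\<^sup>L Q h - \<epsilon> / 2) < (\<integral>\<^sup>+x. ennreal (h x) \<partial>Qs n) \<or> integral\<^sup>L Q h - \<epsilon> / 2 < 0"
  proof (cases "integral\<^sup>L Q h - \<epsilon> / 2 < 0")
    case False
    hence "ennreal (integral\<^sup>L Q h - \<epsilon> / 2) < (\<integral>\<^sup>+x. ennreal (h x) \<partial>Q)"
      using \<epsilon> hR(2)[OF Q m(1)] by (simp add: ennreal_less_iff)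
    also have "\<dots> \<le> liminf (\<lambda>n. \<integral>\<^sup>+x. ennreal (h x) \<partial>Qs n)"
      by (rule weakly_converges_liminf_nn_integral[OF Qs Q w hc h0])
    finally show ?thesis by (rule less_LiminfD[THEN eventually_mono]) simp
  qed simp
  from 1 2 show ?thesis
  proof eventually_elim
    case (elim n)
    have mn: "first_moment (Qs n) < \<infinity>" using order_less_trans[OF elim(1) ennreal_less_top] by simp
    note mQn = first_moment_finiteD(2)[OF Qs mn]
    have "integral\<^sup>L (Qs n) norm \<ge> 0" by (rule Bochner_Integration.integral_nonneg) simp
    hence "integral\<^sup>L (Qs n) norm < integral\<^sup>L Q norm + \<eta>" using elim(1) unfolding mQn by (simp add: ennreal_less_iff del: ennreal_plus)
    hence "K * integral\<^sup>L (Qs n) norm \<le> K * (integral\<^sup>L Q norm + \<eta>)" using K by (intro mult_left_mono) auto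
    hence "K * integral\<^sup>L (Qs n) norm \<le> K * integral\<^sup>L Q norm + \<epsilon> / 2" using \<eta>(2) by (simp add: distrib_left)
    moreover have "integral\<^sup>L Q h - \<epsilon> / 2 \<le> integral\<^sup>L (Qs n) h"
    proof (cases "integral\<^sup>L Q h - \<epsilon> / 2 < 0")
      case True thus ?thesis using hR(3)[OF Qs mn] by linarith
    next
      case False
      thus ?thesis using elim(2) hR(2)[OF Qs mn] by (simp add: ennreal_less_iff)
    qed
    ultimately show ?case using mn hR(1)[OF Q m(1)] hR(1)[OF Qs mn] by simp
  qed
qed

lemma L_sup_le_liminf:
  fixes Qs :: "nat \<Rightarrow> 'a::euclidean_space measure"
  assumes Qs: "\<And>n. Qs n \<in> distributions" and Q: "Q \<in> Qo" and w: "weakly_converges Qs Q"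
    and m: "limsup (\<lambda>n. first_moment (Qs n)) \<le> first_moment Q"
  shows "L_sup Q \<le> liminf (\<lambda>n. L_sup (Qs n))"
  unfolding le_Liminf_iff
proof (intro allI impI)
  fix y assume "y < L_sup Q"
  then obtain \<phi> where \<phi>: "\<phi> \<in> Phi" "y < L_fun \<phi> Q" by (rule L_sup_witness)
  from ereal_dense2[OF \<phi>(2)] obtain l where l: "y < ereal l" "ereal l < L_fun \<phi> Q" by blast
  have Qd: "Q \<in> distributions" using Q by (simp add: Qo_def)
  obtain a r \<delta> where r: "r > 0" "\<delta> > 0" "\<delta> \<le> 1" and sp: "spreads a r \<delta> Q" by (rule spreads_Qo[OF Q])
  obtain \<alpha> \<beta> c I0 where \<beta>: "\<beta> > 0" and ctl: "\<And>Q \<phi>. Q \<in> distributions \<Longrightarrow> spreads a r \<delta> Q \<Longrightarrow> \<phi> \<in> Phi \<Longrightarrow> ereal l \<le> L_fun \<phi> Q \<Longrightarrow>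
     controlled \<alpha> \<beta> a r c I0 \<phi>"
    by (rule near_maximizer_control[OF r, where l=l and a=a], rule that)
  note c = ctl[OF Qd sp \<phi>(1) less_imp_le[OF l(2)]]
  from ereal_dense2[OF l(2)] obtain l' where l': "l < l'" "ereal l' < L_fun \<phi> Q" by auto
  define \<epsilon> where "\<epsilon> = (l' - l) / 2"
  have \<epsilon>: "\<epsilon> > 0" using l'(1) by (simp add: \<epsilon>_def)
  obtain K where maj: "\<And>Q \<phi> l. Q \<in> distributions \<Longrightarrow> \<phi> \<in> Phi \<Longrightarrow> controlled \<alpha> \<beta> a r c I0 \<phi> \<Longrightarrow> ereal l \<le> L_fun \<phi> Q \<Longrightarrow>
      first_moment Q < \<infinity> \<and> (\<exists>f J. tempered K \<alpha> \<beta> a c f \<and> 0 \<le> J \<and>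
        (\<integral>\<^sup>+x. ennreal (exp (f x)) \<partial>lborel) = ennreal J \<and> l \<le> integral\<^sup>L Q f - J + 1 + \<epsilon>)"
    by (rule near_maximizer_majorant[OF r(1) \<beta> \<epsilon>, where \<alpha>=\<alpha> and a=a and c=c and ?I0.0=I0], rule that)
  from maj[OF Qd \<phi>(1) c less_imp_le[OF l'(2)]] obtain f J where mf: "first_moment Q < \<infinity>" and tf: "tempered K \<alpha> \<beta> a c f"
    and J: "(\<integral>\<^sup>+x. ennreal (exp (f x)) \<partial>lborel) = ennreal J" "0 \<le> J"
    and lJ: "l' \<le> integral\<^sup>L Q f - J + 1 + \<epsilon>" by blast
  have f: "K-lipschitz_on UNIV f" "(\<lambda>x. ereal (f x)) \<in> Phi" using tf by (auto simp: tempered_def)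
  show "\<forall>\<^sub>F n in sequentially. y < L_sup (Qs n)"
    using Lipschitz_integral_lower[OF Qs Qd w mf m f(1) \<epsilon>]
  proof eventually_elim
    case (elim n)
    have "l \<le> integral\<^sup>L (Qs n) f - J + 1" using elim lJ unfolding \<epsilon>_def by (simp add: field_simps)
    hence "ereal l \<le> L_fun (\<lambda>x. ereal (f x)) (Qs n)"
      using elim by (simp add: L_fun_real[OF Lipschitz_integrable[OF Qs _ f(1)] J])
    also have "\<dots> \<le> L_sup (Qs n)" by (rule L_fun_le_L_sup[OF f(2)])
    finally show ?case using l(1) by (rule less_le_trans[rotated])
  qed
qed

text \<open>If \<open>L(Q\<^sub>n)\<close> is at least \<open>l\<close> infinitely often, the first moments are bounded along that subsequence,
  so \<open>Q\<close> has finite first moment and the transfer estimate applies. In it, \<open>m\<^sub>n - m\<close> is almost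
  nonnegative.\<close>

lemma limsup_L_sup_le:
  fixes Qs :: "nat \<Rightarrow> 'a::euclidean_space measure"
  assumes Qs: "\<And>n. Qs n \<in> distributions" and Q: "Q \<in> Qo" and w: "weakly_converges Qs Q"
  shows "limsup (\<lambda>n. L_sup (Qs n)) \<le> L_sup Q"
proof (rule ccontr)
  assume "\<not> ?thesis"
  hence "L_sup Q < limsup (\<lambda>n. L_sup (Qs n))" by simp
  from ereal_dense2[OF this] obtain l0 where l0: "L_sup Q < ereal l0" "ereal l0 < limsup (\<lambda>n. L_sup (Qs n))" by blast
  from ereal_dense2[OF l0(2)] obtain l where l: "l0 < l" "ereal l < limsup (\<lambda>n. L_sup (Qs n))" by auto
  have freq: "\<exists>\<^sub>F n in sequentially. ereal l < L_sup (Qs n)" by (rule frequently_less_limsup[OF l(2)])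
  have Qd: "Q \<in> distributions" using Q by (simp add: Qo_def)
  have lim: "first_moment Q \<le> liminf (\<lambda>n. first_moment (Qs n))" by (rule first_moment_liminf[OF Qs Qd w])
  have mf: "first_moment Q < \<infinity>"
  proof -
    obtain a r \<delta> where r: "r > 0" "\<delta> > 0" "\<delta> \<le> 1" and sp: "\<forall>\<^sub>F n in sequentially. spreads a r \<delta> (Qs n)"
      by (rule spreads_eventually[OF Qs Q w])
    obtain \<alpha> \<beta> c I0 where \<beta>: "\<beta> > 0" and ctl: "\<And>Q \<phi>. Q \<in> distributions \<Longrightarrow> spreads a r \<delta> Q \<Longrightarrow> \<phi> \<in> Phi \<Longrightarrow> ereal l \<le> L_fun \<phi> Q \<Longrightarrow>
       controlled \<alpha> \<beta> a r c I0 \<phi>"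
      by (rule near_maximizer_control[OF r, where l=l and a=a], rule that)
    let ?B = "ennreal ((\<alpha> + 1 - l) / \<beta>)"
    have bd: "\<exists>\<^sub>F n in sequentially. first_moment (Qs n) \<le> ?B"
      using frequently_eventually_frequently[OF freq sp]
    proof (rule frequently_elim1)
      fix n assume n: "ereal l < L_sup (Qs n) \<and> spreads a r \<delta> (Qs n)"
      then obtain \<phi> where \<phi>: "\<phi> \<in> Phi" "ereal l < L_fun \<phi> (Qs n)" using L_sup_witness by blast
      have "\<phi> x \<le> ereal (\<alpha> - \<beta> * norm x)" for x using ctl[OF Qs _ \<phi>(1) less_imp_le[OF \<phi>(2)]] n by (simp add: controlled_def)
      thus "first_moment (Qs n) \<le> ?B" by (rule first_moment_bound_of_L_fun[OF Qs \<beta>]) (use \<phi>(2) in simp)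
    qed
    show ?thesis
    proof (rule ccontr)
      assume "\<not> ?thesis"
      hence "?B < first_moment Q" by (simp add: less_top[symmetric])
      also note lim
      finally have "?B < liminf (\<lambda>n. first_moment (Qs n))" .
      from less_LiminfD[OF this] bd show False
        by (auto simp: frequently_def not_le elim!: eventually_mono)
    qed
  qed
  obtain \<beta> where \<beta>: "\<beta> > 0" and tr: "\<And>\<epsilon>. \<epsilon> > 0 \<Longrightarrow> \<forall>\<^sub>F n in sequentially. \<forall>\<phi>\<in>Phi. \<forall>s\<ge>l. ereal s \<le> L_fun \<phi> (Qs n) \<longrightarrow>
     first_moment (Qs n) < \<infinity> \<and> ereal (s + \<beta> * (integral\<^sup>L (Qs n) norm - integral\<^sup>L Q norm) - \<epsilon>) \<le> L_sup Q"
    by (rule near_maximizer_transfer[OF Qs Q w mf, where l=l], rule that)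
  define \<epsilon> where "\<epsilon> = (l - l0) / 2"
  have \<epsilon>: "\<epsilon> > 0" using l(1) by (simp add: \<epsilon>_def)
  define q where "q = integral\<^sup>L Q norm - \<epsilon> / \<beta>"
  have ev: "\<forall>\<^sub>F n in sequentially. ennreal q < first_moment (Qs n) \<or> q < 0"
  proof (cases "q < 0")
    case False
    hence "ennreal q < first_moment Q"
      unfolding first_moment_finiteD(2)[OF Qd mf] using \<epsilon> \<beta> by (simp add: ennreal_less_iff q_def)
    also note lim
    finally show ?thesis by (rule less_LiminfD[THEN eventually_mono]) simp
  qed simp
  from frequently_eventually_frequently[OF freq eventually_conj[OF tr[OF \<epsilon>] ev]] obtain n where
    n: "ereal l < L_sup (Qs n)"
       "\<forall>\<phi>\<in>Phi. \<forall>s\<ge>l. ereal s \<le> L_fun \<phi> (Qs n) \<longrightarrow>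
     first_moment (Qs n) < \<infinity> \<and> ereal (s + \<beta> * (integral\<^sup>L (Qs n) norm - integral\<^sup>L Q norm) - \<epsilon>) \<le> L_sup Q"
       "ennreal q < first_moment (Qs n) \<or> q < 0"
    using frequently_ex by blast
  from n(1) obtain \<phi> where "\<phi> \<in> Phi" "ereal l < L_fun \<phi> (Qs n)" by (rule L_sup_witness)
  hence c: "first_moment (Qs n) < \<infinity>" "ereal (l + \<beta> * (integral\<^sup>L (Qs n) norm - integral\<^sup>L Q norm) - \<epsilon>) \<le> L_sup Q"
    using n(2) less_imp_le by blast+
  have p: "integral\<^sup>L (Qs n) norm \<ge> 0" by (rule Bochner_Integration.integral_nonneg) simp
  have "q \<le> integral\<^sup>L (Qs n) norm"
  proof (cases "q < 0")
    case False
    thus ?thesis using n(3) unfolding first_moment_finiteD(2)[OF Qs c(1)] by (simp add: ennreal_less_iff)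
  qed (use p in linarith)
  hence "\<beta> * (integral\<^sup>L Q norm - integral\<^sup>L (Qs n) norm) \<le> \<beta> * (\<epsilon> / \<beta>)"
    using \<beta> by (intro mult_left_mono) (auto simp: q_def)
  hence "\<beta> * (integral\<^sup>L (Qs n) norm - integral\<^sup>L Q norm) \<ge> - \<epsilon>" using \<beta> by (simp add: algebra_simps)
  moreover have "l - 2 * \<epsilon> = l0" unfolding \<epsilon>_def by (simp add: field_simps)
  ultimately have "l0 \<le> l + \<beta> * (integral\<^sup>L (Qs n) norm - integral\<^sup>L Q norm) - \<epsilon>" by linarith
  hence "ereal l0 \<le> L_sup Q" using c(2) by (meson ereal_less_eq(3) order_trans)
  thus False using l0(1) by simp
qed

text \<open>If \<open>L(Q\<^sub>n)\<close> came close to \<open>L(Q)\<close> for all large \<open>n\<close>, then at the infinitely many \<open>n\<close> with excess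
  moment the transfer estimate would produce a value above \<open>L(Q)\<close>.\<close>

lemma liminf_L_sup_less:
  fixes Qs :: "nat \<Rightarrow> 'a::euclidean_space measure"
  assumes Qs: "\<And>n. Qs n \<in> distributions" and Q: "Q \<in> Qo" and w: "weakly_converges Qs Q"
    and m: "first_moment Q < limsup (\<lambda>n. first_moment (Qs n))"
  shows "liminf (\<lambda>n. L_sup (Qs n)) < L_sup Q"
proof (rule ccontr)
  assume nl: "\<not> ?thesis"
  have Qd: "Q \<in> distributions" using Q by (simp add: Qo_def)
  have mf: "first_moment Q < \<infinity>" using m by (metis infinity_ennreal_def less_le_trans top_greatest)
  obtain v where v: "L_sup Q = ereal v" by (rule L_sup_finite[OF Q mf])
  obtain \<beta> where \<beta>: "\<beta> > 0" and tr: "\<And>\<epsilon>. \<epsilon> > 0 \<Longrightarrow> \<forall>\<^sub>F n in sequentially. \<forall>\<phi>\<in>Phi. \<forall>s\<ge>v - 1. ereal s \<le> L_fun \<phi> (Qs n) \<longrightarrow>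
     first_moment (Qs n) < \<infinity> \<and> ereal (s + \<beta> * (integral\<^sup>L (Qs n) norm - integral\<^sup>L Q norm) - \<epsilon>) \<le> L_sup Q"
    by (rule near_maximizer_transfer[OF Qs Q w mf, where l="v - 1"], rule that)
  from dense[OF m] obtain q' where q': "first_moment Q < q'" "q' < limsup (\<lambda>n. first_moment (Qs n))" by blast
  then obtain q where q: "q \<ge> 0" "q' = ennreal q" by (metis ennreal_cases less_top order_less_le_trans top_greatest)
  note mQ = first_moment_finiteD(2)[OF Qd mf]
  have gap: "integral\<^sup>L Q norm < q" using q'(1) unfolding mQ q(2) by (simp add: ennreal_less_iff)
  \<comment> \<open>Two losses of \<open>\<epsilon>\<close>, one from near-maximality and one from the transfer, must stay below the gain from
    the excess moment; \<open>\<epsilon> \<le> 1\<close> keeps the values above the level \<open>v - 1\<close> of the transfer estimate.\<close>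
  define \<epsilon> where "\<epsilon> = min 1 (\<beta> * (q - integral\<^sup>L Q norm) / 4)"
  have \<epsilon>: "\<epsilon> > 0" "\<epsilon> \<le> 1" "4 * \<epsilon> \<le> \<beta> * (q - integral\<^sup>L Q norm)" using \<beta> gap by (auto simp: \<epsilon>_def)
  have "ereal (v - \<epsilon>) < liminf (\<lambda>n. L_sup (Qs n))" using nl v \<epsilon>(1) by (metis diff_gt_0_iff_gt diff_diff_eq2 add_diff_cancel_left' less_ereal.simps(1) not_less order_less_le_trans)
  from less_LiminfD[OF this] have ev: "\<forall>\<^sub>F n in sequentially. ereal (v - \<epsilon>) < L_sup (Qs n)" .
  from frequently_eventually_frequently[OF frequently_less_limsup[OF q'(2)] eventually_conj[OF tr[OF \<epsilon>(1)] ev]] obtain n where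
    n: "q' < first_moment (Qs n)" "ereal (v - \<epsilon>) < L_sup (Qs n)"
       "\<forall>\<phi>\<in>Phi. \<forall>s\<ge>v - 1. ereal s \<le> L_fun \<phi> (Qs n) \<longrightarrow>
     first_moment (Qs n) < \<infinity> \<and> ereal (s + \<beta> * (integral\<^sup>L (Qs n) norm - integral\<^sup>L Q norm) - \<epsilon>) \<le> L_sup Q"
    using frequently_ex by blast
  from n(2) obtain \<phi> where "\<phi> \<in> Phi" "ereal (v - \<epsilon>) < L_fun \<phi> (Qs n)" by (rule L_sup_witness)
  moreover have "v - \<epsilon> \<ge> v - 1" using \<epsilon> by simp
  ultimately have c: "first_moment (Qs n) < \<infinity>"
     "ereal (v - \<epsilon> + \<beta> * (integral\<^sup>L (Qs n) norm - integral\<^sup>L Q norm) - \<epsilon>) \<le> L_sup Q"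
    using n(3) less_imp_le by blast+
  have "q < integral\<^sup>L (Qs n) norm"
    using n(1) q unfolding first_moment_finiteD(2)[OF Qs c(1)] by (simp add: ennreal_less_iff)
  hence "\<beta> * (q - integral\<^sup>L Q norm) \<le> \<beta> * (integral\<^sup>L (Qs n) norm - integral\<^sup>L Q norm)"
    using \<beta> by (intro mult_left_mono) auto
  thus False using c(2) v \<epsilon> by simp
qed

theorem theorem2p14:
  fixes Qs :: "nat \<Rightarrow> 'a::euclidean_space measure" and Q :: "'a measure"
  assumes "\<And>n. Qs n \<in> Qo" and "Q \<in> Qo"
    and "weakly_converges Qs Q"
  shows "limsup (\<lambda>n. L_sup (Qs n)) \<le> L_sup Q \<and>
         (liminf (\<lambda>n. L_sup (Qs n)) < L_sup Q \<longleftrightarrow>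
          limsup (\<lambda>n. first_moment (Qs n)) > first_moment Q)"
proof -
  have Qs: "Qs n \<in> distributions" for n using assms(1) by (simp add: Qo_def)
  note prems = Qs assms(2,3)
  show ?thesis
    using limsup_L_sup_le[OF prems] L_sup_le_liminf[OF prems] liminf_L_sup_less[OF prems]
    by (meson linorder_not_less)
qed

end
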